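(* Let $H$ be a finite graph with loops allowed and let $w$ be an infinite almost periodic word over the alphabet $V(H)$. Then the class $\mathcal{P}(w,H)$ is a boundary class for well-quasi-ordering by the induced subgraph relation.
   Context: Graphs (other than $H$) are finite and simple, considered up to isomorphism. A (hereditary) class of graphs is a collection of graphs closed under taking induced subgraphs. A class is well-quasi-ordered if it contains no infinite antichain under the induced subgraph relation. Words: a finite word $u=u_1\cdots u_m$ is a factor of $w=w_1w_2\cdots$ if there is $a\ge 0$ with $u_i=w_{a+i}$ for all $1\le i\le m$. An infinite word $w$ is almost periodic if for every finite factor $u$ of $w$ there is a constant $c$ such that every factor of $w$ of length $c$ contains $u$ as a factor. The class $\mathcal{P}(w,H)$: for positive integers $i_1<i_2<\cdots<i_k$, let $G_{w,H}(i_1,\dots,i_k)$ be the graph with vertex set $\{i_1,\dots,i_k\}$ in which distinct $i_j,i_{j'}$ are adjacent if and only if either $|i_j-i_{j'}|=1$ and $w_{i_j}w_{i_{j'}}\notin E(H)$, or $|i_j-i_{j'}|>1$ and $w_{i_j}w_{i_{j'}}\in E(H)$ (when the two letters coincide, this refers to the presence of a loop in $H$). $\mathcal{P}(w,H)$ is the hereditary class of all graphs (isomorphic to) $G_{w,H}(i_1,\dots,i_k)$ over all finite increasing sequences of positive integers. Limit and boundary classes: a class $\mathcal{C}$ is a limit class if there is a sequence of classes $\mathcal{C}_1\supseteq\mathcal{C}_2\supseteq\cdots$ (inclusions not necessarily strict), none of which is well-quasi-ordered, with $\mathcal{C}=\bigcap_{i=1}^\infty\mathcal{C}_i$. A boundary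 class is a limit class that is minimal under inclusion among limit classes, i.e. no proper subclass of it is a limit class. *)

theory Defs
  imports
    "Graph_Theory.Pair_Digraph"
    "Graph_Theory.Digraph_Isomorphism"
    "HOL-Library.Sublist"
begin

text \<open>
  A finite simple graph is a \<open>pair_graph\<close> (finite, symmetric, loop-free) with vertices in
  \<^typ>\<open>nat\<close>. Every finite graph has an isomorphic copy of this kind, so a collection of graphs
  ``up to isomorphism'' is an isomorphism-closed set of such graphs. The null graph is a graph.
\<close>

type_synonym ngraph = "nat pair_pre_digraph"

definition graph_class :: "ngraph set \<Rightarrow> bool" where
  "graph_class C \<longleftrightarrow>
     (\<forall>G\<in>C. pair_graph G) \<and>
     (\<forall>G\<in>C. \<forall>K. digraph_iso (with_proj G) (with_proj K) \<longrightarrow> K \<in> C) \<and>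
     (\<forall>G\<in>C. \<forall>K. induced_subgraph (with_proj K) (with_proj G) \<longrightarrow> K \<in> C)"

text \<open>The induced subgraph relation on isomorphism types.\<close>

definition induced_le :: "ngraph \<Rightarrow> ngraph \<Rightarrow> bool" where
  "induced_le G K \<longleftrightarrow> (\<exists>G'. induced_subgraph (with_proj G') (with_proj K) \<and> digraph_iso (with_proj G) (with_proj G'))"

text \<open>
  Isomorphic graphs are comparable, so the members of an antichain are pairwise non-isomorphic.
\<close>

definition induced_antichain :: "ngraph set \<Rightarrow> bool" where
  "induced_antichain A \<longleftrightarrow> (\<forall>G\<in>A. \<forall>K\<in>A. G \<noteq> K \<longrightarrow> \<not> induced_le G K)"

definition well_quasi_ordered :: "ngraph set \<Rightarrow> bool" where
  "well_quasi_ordered C \<longleftrightarrow> \<not> (\<exists>A\<subseteq>C. infinite A \<and> induced_antichain A)"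

definition limit_class :: "ngraph set \<Rightarrow> bool" where
  "limit_class C \<longleftrightarrow>
     (\<exists>D :: nat \<Rightarrow> ngraph set.
        (\<forall>i. graph_class (D i) \<and> \<not> well_quasi_ordered (D i) \<and> D (Suc i) \<subseteq> D i) \<and>
        C = (\<Inter>i. D i))"

definition boundary_class :: "ngraph set \<Rightarrow> bool" where
  "boundary_class C \<longleftrightarrow> limit_class C \<and> (\<forall>D. D \<subset> C \<longrightarrow> \<not> limit_class D)"

text \<open>
  An infinite word $w_1 w_2 \cdots$ is a function on \<^typ>\<open>nat\<close> of which only the values at positive
  arguments matter: the value at \<open>0\<close> is never used.
\<close>

definition word_factor :: "'v list \<Rightarrow> (nat \<Rightarrow> 'v) \<Rightarrow> bool" where
  "word_factor u w \<longleftrightarrow> (\<exists>a. \<forall>i\<in>{1..length u}. u ! (i - 1) = w (a + i))"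

definition almost_periodic :: "(nat \<Rightarrow> 'v) \<Rightarrow> bool" where
  "almost_periodic w \<longleftrightarrow>
     (\<forall>u. word_factor u w \<longrightarrow>
        (\<exists>c. \<forall>v. word_factor v w \<and> length v = c \<longrightarrow> sublist u v))"

text \<open>
  \<open>word_graph w H I\<close> is $G_{w,H}(i_1,\dots,i_k)$ for \<open>I\<close> the set $\{i_1 < \dots < i_k\}$.
  The edge set of \<open>H\<close> is the symmetric relation \<open>parcs H\<close>, where \<open>(x, x)\<close> is a loop at \<open>x\<close>.
\<close>

definition word_graph :: "(nat \<Rightarrow> 'v) \<Rightarrow> 'v pair_pre_digraph \<Rightarrow> nat set \<Rightarrow> ngraph" where
  "word_graph w H I =
     \<lparr> pverts = I,
       parcs = {(i, j). i \<in> I \<and> j \<in> I \<and>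
         (\<bar>int i - int j\<bar> = 1 \<and> (w i, w j) \<notin> parcs H \<or>
          \<bar>int i - int j\<bar> > 1 \<and> (w i, w j) \<in> parcs H)} \<rparr>"

definition word_class :: "(nat \<Rightarrow> 'v) \<Rightarrow> 'v pair_pre_digraph \<Rightarrow> ngraph set" where
  "word_class w H =
     {K. \<exists>I. finite I \<and> I \<subseteq> {1..} \<and> digraph_iso (with_proj (word_graph w H I)) (with_proj K)}"

end

theory Submission
  imports Defs "HOL-Library.Infinite_Set"
begin

text \<open>
  The class of a word \<open>w\<close> consists of the finite graphs that embed into the graph on all positions of
  \<open>w\<close>. Adjacency in that graph follows the letters, except that it is flipped between consecutive
  positions.

  The class is a limit class. Let \<open>C\<^sub>k\<close> consist of the graphs all of whose induced subgraphs on at most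
  \<open>k\<close> vertices lie in the word class; these classes decrease to the word class. To see that \<open>C\<^sub>k\<close> is not
  well-quasi-ordered, close prefixes of \<open>w\<close> into cycles at places where the prefix of length \<open>k\<close> recurs.
  The closed-up word still has only factors of \<open>w\<close> as windows of length at most \<open>k\<close>, so its graph is
  in \<open>C\<^sub>k\<close> (\<open>cyclic_word_graph_local\<close>). If every letter occurs often enough, an embedding between
  such graphs must respect the cycles (\<open>flips_preserved\<close>), and a cycle is not an induced subgraph of
  a longer one; so these graphs form an antichain (\<open>cyclic_word_graphs_incomparable\<close>).

  The class is minimal. Forbidding one of its graphs bounds the length of the runs of consecutive
  positions (\<open>forbidding_bounds_runs\<close>), because every long factor of \<open>w\<close> contains any given
  factor. The graph depends only on the multiset of its runs, so what remains are multisets over finitely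
  many words, and Dickson's lemma makes them well-quasi-ordered. This remains true if each position
  carries a label from a two-element set, hence also for graphs with one additional vertex
  (\<open>one_vertex_extensions_wqo\<close>). A well-quasi-ordering under such labels permits only finitely many
  minimal obstructions. A decreasing sequence of classes whose intersection avoids the forbidden graph
  and is contained in the word class excludes each obstruction at some stage, hence all of them,
  and is well-quasi-ordered from then on. The proof of \<open>not_limit_class_below\<close> runs this argument
  directly on a sequence of minimal obstructions.
\<close>

section \<open>Induced embeddings\<close>

text \<open>
  An isomorphism of digraphs consists of separate maps on vertices and on arcs. All of the combinatorics
  below concerns one map on vertices, so isomorphism and the induced subgraph relation are first
  translated into injections that preserve and reflect adjacency. The source and target may be infinite,
  which lets one infinite graph represent a whole word.
\<close>

definition induced_emb :: "(nat \<Rightarrow> nat) \<Rightarrow> ngraph \<Rightarrow> ngraph \<Rightarrow> bool" where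
  "induced_emb f G K \<longleftrightarrow> inj_on f (pverts G) \<and> f ` pverts G \<subseteq> pverts K \<and>
     (\<forall>x\<in>pverts G. \<forall>y\<in>pverts G. (x, y) \<in> parcs G \<longleftrightarrow> (f x, f y) \<in> parcs K)"

definition induce :: "ngraph \<Rightarrow> nat set \<Rightarrow> ngraph" where
  "induce G S = \<lparr>pverts = S, parcs = {(x, y) \<in> parcs G. x \<in> S \<and> y \<in> S}\<rparr>"

lemma induce_simps [simp]:
  "pverts (induce G S) = S"
  "(x, y) \<in> parcs (induce G S) \<longleftrightarrow> (x, y) \<in> parcs G \<and> x \<in> S \<and> y \<in> S"
  by (auto simp: induce_def)

lemma pair_wf_induce [simp]: "pair_wf_digraph (induce G S)"
  by unfold_locales (auto simp: induce_def)

lemma induced_emb_trans: "induced_emb f G K \<Longrightarrow> induced_emb g K L \<Longrightarrow> induced_emb (g \<circ> f) G L"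
  unfolding induced_emb_def by (auto simp: inj_on_def image_subset_iff)

lemma induced_emb_inverse:
  assumes g: "induced_emb g G K" "g ` pverts G = pverts K"
  obtains h where "induced_emb h K G" "h ` pverts K = pverts G"
proof
  let ?h = "the_inv_into (pverts G) g"
  have "bij_betw g (pverts G) (pverts K)" using g unfolding induced_emb_def bij_betw_def by blast
  then have h: "bij_betw ?h (pverts K) (pverts G)" and gh: "\<And>x. x \<in> pverts K \<Longrightarrow> g (?h x) = x"
    by (rule bij_betw_the_inv_into, rule f_the_inv_into_f_bij_betw)
  then have hV: "?h x \<in> pverts G" if "x \<in> pverts K" for x
    using that bij_betwE by blast
  show "?h ` pverts K = pverts G" using h by (rule bij_betw_imp_surj_on)
  moreover have "inj_on ?h (pverts K)" using h by (rule bij_betw_imp_inj_on)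
  moreover have "(x, y) \<in> parcs K \<longleftrightarrow> (?h x, ?h y) \<in> parcs G"
    if x: "x \<in> pverts K" and y: "y \<in> pverts K" for x y
    using g(1) hV[OF x] hV[OF y] gh[OF x] gh[OF y] unfolding induced_emb_def by simp
  ultimately show "induced_emb ?h K G" unfolding induced_emb_def by blast
qed

lemma induced_emb_induce: "S \<subseteq> pverts G \<Longrightarrow> induced_emb id (induce G S) G"
  unfolding induced_emb_def by auto

lemma induced_emb_induce_induce:
  "induced_emb f G K \<Longrightarrow> S \<subseteq> pverts G \<Longrightarrow> f ` S \<subseteq> T \<Longrightarrow> induced_emb f (induce G S) (induce K T)"
  unfolding induced_emb_def by (auto simp: inj_on_def image_subset_iff subset_iff)

lemma pair_graph_iff:
  "pair_graph G \<longleftrightarrow> pair_wf_digraph G \<and> finite (pverts G) \<and>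
     (\<forall>x y. (x, y) \<in> parcs G \<longrightarrow> (y, x) \<in> parcs G) \<and> (\<forall>x. (x, x) \<notin> parcs G)"
  (is "_ \<longleftrightarrow> ?R")
proof
  assume "pair_graph G"
  then interpret pair_graph G .
  show ?R by (auto intro: arcs_symmetric dest: no_loops' intro: pair_wf_digraph_axioms)
next
  assume R: ?R
  then interpret pair_wf_digraph G by simp
  have "parcs G \<subseteq> pverts G \<times> pverts G"
    using arc_fst_in_verts arc_snd_in_verts by (force simp: mem_Times_iff)
  then have "finite (parcs G)"
    using R by (meson finite_SigmaI finite_subset)
  then show "pair_graph G"
    using R by unfold_locales (auto simp: symmetric_def intro!: symI)
qed

lemma pair_graph_wf: "pair_graph G \<Longrightarrow> pair_wf_digraph G"
  by (simp add: pair_graph_iff)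

lemma induced_emb_pair_graph:
  assumes "induced_emb f G K" "pair_wf_digraph G" "finite (pverts G)"
    and "\<And>x y. (x, y) \<in> parcs K \<Longrightarrow> (y, x) \<in> parcs K" "\<And>x. (x, x) \<notin> parcs K"
  shows "pair_graph G"
proof -
  interpret pair_wf_digraph G by fact
  show ?thesis
    unfolding pair_graph_iff
  proof (intro conjI allI impI)
    fix x y assume "(x, y) \<in> parcs G"
    then show "(y, x) \<in> parcs G"
      using assms(1,4) in_arcsD1[of x y] in_arcsD2[of x y] unfolding induced_emb_def by blast
  next
    fix x show "(x, x) \<notin> parcs G"
      using assms(1,5) in_arcsD1[of x x] unfolding induced_emb_def by blast
  qed fact+
qed

lemma digraph_iso_iff:
  assumes wf: "pair_wf_digraph G"
  shows "digraph_iso (with_proj G) (with_proj K) \<longleftrightarrow>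
     pair_wf_digraph K \<and> (\<exists>f. induced_emb f G K \<and> f ` pverts G = pverts K)" (is "_ \<longleftrightarrow> ?R")
proof
  interpret pair_wf_digraph G by fact
  assume "digraph_iso (with_proj G) (with_proj K)"
  then obtain h where h: "digraph_isomorphism h" and K: "with_proj K = app_iso h (with_proj G)"
    unfolding digraph_iso_def by auto
  have "wf_digraph (app_iso h (with_proj G))"
    using h by (rule wf_digraphI_app_iso)
  then have wfK: "pair_wf_digraph K"
    unfolding K[symmetric] wf_digraph_wp_iff .
  let ?f = "iso_verts h"
  have v: "pverts K = ?f ` pverts G" and a: "parcs K = iso_arcs h ` parcs G"
    and tl: "iso_tail h = fst" and hd: "iso_head h = snd"
    using arg_cong[OF K, of verts] arg_cong[OF K, of arcs] arg_cong[OF K, of tail] arg_cong[OF K, of head]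
    by auto
  have arc: "iso_arcs h (x, y) = (?f x, ?f y)" if "(x, y) \<in> parcs G" for x y
    using iso_verts_tail[OF h that] iso_verts_head[OF h that] by (simp add: tl hd prod_eq_iff)
  have inj: "inj_on ?f (pverts G)"
    using digraph_isomorphism_inj_on_verts[OF h] .
  have "(x, y) \<in> parcs G \<longleftrightarrow> (?f x, ?f y) \<in> parcs K" if x: "x \<in> pverts G" and y: "y \<in> pverts G" for x y
  proof
    assume "(x, y) \<in> parcs G"
    then show "(?f x, ?f y) \<in> parcs K" unfolding a by (metis arc imageI)
  next
    assume "(?f x, ?f y) \<in> parcs K"
    then obtain x' y' where e: "(x', y') \<in> parcs G" "(?f x, ?f y) = iso_arcs h (x', y')"
      unfolding a by auto
    then have "?f x = ?f x'" "?f y = ?f y'" using arc by auto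
    then have "x = x'" "y = y'" using inj x y e(1) in_arcsD1 in_arcsD2 by (metis inj_onD)+
    then show "(x, y) \<in> parcs G" using e by simp
  qed
  then have "induced_emb ?f G K" unfolding induced_emb_def using inj v by auto
  then show ?R using wfK v by auto
next
  interpret pair_wf_digraph G by fact
  assume ?R
  then obtain f where f: "induced_emb f G K" "f ` pverts G = pverts K" and wfK: "pair_wf_digraph K" by auto
  interpret K: pair_wf_digraph K by fact
  define h where "h = \<lparr>iso_verts = f, iso_arcs = map_prod f f, iso_head = snd, iso_tail = fst\<rparr>"
  have inj: "inj_on f (pverts G)" using f unfolding induced_emb_def by auto
  have "inj_on (map_prod f f) (parcs G)"
    by (rule inj_on_subset[OF map_prod_inj_on[OF inj inj]]) (auto dest: in_arcsD1 in_arcsD2)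
  then have "digraph_isomorphism h"
    unfolding digraph_isomorphism_def h_def using inj wf_digraph by auto
  moreover have "parcs K = map_prod f f ` parcs G"
  proof (intro equalityI subsetI)
    fix e assume e: "e \<in> parcs K"
    obtain a b where ab: "e = (a, b)" by fastforce
    then have "a \<in> pverts K" "b \<in> pverts K" using e K.in_arcsD1 K.in_arcsD2 by auto
    then obtain x y where "x \<in> pverts G" "y \<in> pverts G" "a = f x" "b = f y" using f(2) by blast
    then show "e \<in> map_prod f f ` parcs G" using e ab f(1) unfolding induced_emb_def by force
  next
    fix e assume "e \<in> map_prod f f ` parcs G"
    then obtain x y where "(x, y) \<in> parcs G" "e = (f x, f y)" by auto
    then show "e \<in> parcs K" using f(1) in_arcsD1 in_arcsD2 unfolding induced_emb_def by blast
  qed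
  then have "with_proj K = app_iso h (with_proj G)"
    using f(2) by (auto simp: h_def app_iso_def with_proj_def)
  ultimately show "digraph_iso (with_proj G) (with_proj K)"
    unfolding digraph_iso_def by blast
qed

lemma induced_subgraph_iff:
  assumes wf: "pair_wf_digraph G"
  shows "induced_subgraph (with_proj K) (with_proj G) \<longleftrightarrow> (\<exists>S\<subseteq>pverts G. K = induce G S)"
proof
  assume "induced_subgraph (with_proj K) (with_proj G)"
  then have "pverts K \<subseteq> pverts G" "parcs K = {e \<in> parcs G. fst e \<in> pverts K \<and> snd e \<in> pverts K}"
    unfolding induced_subgraph_def subgraph_def by auto
  then show "\<exists>S\<subseteq>pverts G. K = induce G S"
    by (intro exI[of _ "pverts K"]) (auto simp: induce_def intro!: pair_pre_digraph.equality)
next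
  assume "\<exists>S\<subseteq>pverts G. K = induce G S"
  then show "induced_subgraph (with_proj K) (with_proj G)"
    using wf pair_wf_induce unfolding induced_subgraph_def subgraph_def wf_digraph_wp_iff
    by (auto simp: induce_def)
qed

lemma induced_le_iff:
  assumes G: "pair_wf_digraph G" and K: "pair_wf_digraph K"
  shows "induced_le G K \<longleftrightarrow> (\<exists>f. induced_emb f G K)"
proof
  assume "induced_le G K"
  then obtain S f where S: "S \<subseteq> pverts K" and f: "induced_emb f G (induce K S)"
    unfolding induced_le_def induced_subgraph_iff[OF K] digraph_iso_iff[OF G] by auto
  show "\<exists>f. induced_emb f G K" using induced_emb_trans[OF f induced_emb_induce[OF S]] by blast
next
  assume "\<exists>f. induced_emb f G K"
  then obtain f where f: "induced_emb f G K" by blast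
  have "induced_emb f G (induce K (f ` pverts G))" "f ` pverts G \<subseteq> pverts K"
    using f unfolding induced_emb_def by auto
  then show "induced_le G K"
    unfolding induced_le_def induced_subgraph_iff[OF K] digraph_iso_iff[OF G]
    by (metis induce_simps(1) pair_wf_induce)
qed

text \<open>
  A graph class is exactly a set of graphs closed downwards under induced embeddings; this lemma and
  \<open>graph_classI\<close> are the two directions.
\<close>
lemma graph_class_down:
  assumes C: "graph_class C" and K: "K \<in> C" and G: "pair_wf_digraph G" and f: "induced_emb f G K"
  shows "G \<in> C"
proof -
  have "pair_wf_digraph K" using C K pair_graph_wf unfolding graph_class_def by blast
  then obtain G' where G': "induced_subgraph (with_proj G') (with_proj K)"
      "digraph_iso (with_proj G) (with_proj G')"
    using induced_le_iff[OF G] f unfolding induced_le_def by blast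
  then have "pair_wf_digraph G'" "\<exists>g. induced_emb g G G' \<and> g ` pverts G = pverts G'"
    using digraph_iso_iff[OF G] by auto
  then obtain g where g: "induced_emb g G G'" "g ` pverts G = pverts G'" by blast
  obtain h where "induced_emb h G' G" "h ` pverts G' = pverts G"
    using induced_emb_inverse[OF g] by blast
  then have "digraph_iso (with_proj G') (with_proj G)"
    using digraph_iso_iff[OF \<open>pair_wf_digraph G'\<close>] G by blast
  then show ?thesis using C K G'(1) unfolding graph_class_def by blast
qed

lemma graph_classI:
  assumes "\<And>G. G \<in> C \<Longrightarrow> pair_graph G"
    and down: "\<And>G K f. K \<in> C \<Longrightarrow> pair_wf_digraph G \<Longrightarrow> induced_emb f G K \<Longrightarrow> G \<in> C"
  shows "graph_class C"
  unfolding graph_class_def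
proof (intro conjI ballI allI impI)
  fix G and K :: ngraph assume G: "G \<in> C" and iso: "digraph_iso (with_proj G) (with_proj K)"
  have wf: "pair_wf_digraph G" using assms(1)[OF G] by (rule pair_graph_wf)
  obtain g where g: "induced_emb g G K" "g ` pverts G = pverts K" and K: "pair_wf_digraph K"
    using iso digraph_iso_iff[OF wf] by blast
  obtain h where "induced_emb h K G"
    using induced_emb_inverse[OF g] by blast
  then show "K \<in> C" using down[OF G K] by blast
next
  fix G and K :: ngraph assume G: "G \<in> C" and "induced_subgraph (with_proj K) (with_proj G)"
  then obtain S where "S \<subseteq> pverts G" "K = induce G S"
    using induced_subgraph_iff[OF pair_graph_wf[OF assms(1)[OF G]]] by auto
  then show "K \<in> C" using down[OF G, of K] induced_emb_induce by auto
qed (use assms(1) in auto)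

section \<open>Recurrence of factors\<close>

lemma almost_periodic_window:
  assumes "almost_periodic w" and a: "a \<ge> 1"
  obtains c where
    "\<And>b. b \<ge> 1 \<Longrightarrow> \<exists>p\<ge>b. p + k \<le> b + c \<and> (\<forall>i<k. w (p + i) = w (a + i))"
proof -
  let ?u = "map w [a..<a + k]"
  have "word_factor ?u w"
    unfolding word_factor_def using a by (intro exI[of _ "a - 1"]) auto
  then obtain c where c: "\<And>v. word_factor v w \<Longrightarrow> length v = c \<Longrightarrow> sublist ?u v"
    using assms(1) unfolding almost_periodic_def by blast
  have "\<exists>p\<ge>b. p + k \<le> b + c \<and> (\<forall>i<k. w (p + i) = w (a + i))" if b: "b \<ge> 1" for b
  proof -
    let ?v = "map w [b..<b + c]"
    have "word_factor ?v w"
      unfolding word_factor_def using b by (intro exI[of _ "b - 1"]) auto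
    then have "sublist ?u ?v" using c by simp
    then obtain xs ys where v: "?v = xs @ ?u @ ys" unfolding sublist_def by blast
    have len: "length xs + k + length ys = c"
      using arg_cong[OF v, of length] by simp
    have "w (b + length xs + i) = w (a + i)" if i: "i < k" for i
    proof -
      have "?v ! (length xs + i) = ?u ! i"
        unfolding v using i by (simp add: nth_append)
      then show ?thesis using i len by (simp add: add.assoc)
    qed
    then show ?thesis using len by (intro exI[of _ "b + length xs"]) auto
  qed
  then show ?thesis by (rule that)
qed

lemma almost_periodic_recurrent:
  assumes "almost_periodic w" "a \<ge> 1"
  shows "\<exists>p>B. \<forall>i<k. w (p + i) = w (a + i)"
proof -
  obtain c where "\<And>b. b \<ge> 1 \<Longrightarrow> \<exists>p\<ge>b. p + k \<le> b + c \<and> (\<forall>i<k. w (p + i) = w (a + i))"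
    using almost_periodic_window[OF assms] by blast
  from this[of "Suc B"] show ?thesis by (auto simp: Suc_le_eq)
qed

text \<open>
  Long prefixes contain every occurring letter as often as desired. The rigidity argument for cyclic
  word graphs needs this abundance.
\<close>
lemma letter_frequent:
  assumes w: "almost_periodic w" and a: "a \<in> w ` {1..}"
  shows "\<forall>\<^sub>F n in sequentially. M \<le> card {x \<in> {1..n}. w x = a}"
proof -
  obtain x0 where x0: "x0 \<ge> 1" "a = w x0" using a by auto
  have rec: "\<exists>p>B. w p = a" for B
    using almost_periodic_recurrent[OF w x0(1), of B 1] x0(2) by auto
  have inf: "infinite {x. w x = a \<and> x \<ge> 1}"
    unfolding infinite_nat_iff_unbounded
  proof (rule allI)
    fix B :: nat
    obtain p where "p > B" "w p = a" using rec by blast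
    then show "\<exists>p>B. p \<in> {x. w x = a \<and> x \<ge> 1}" by (intro exI[of _ p]) auto
  qed
  obtain T where T: "finite T" "card T = M" "T \<subseteq> {x. w x = a \<and> x \<ge> 1}"
    using infinite_arbitrarily_large[OF inf] by blast
  obtain N where N: "\<And>x. x \<in> T \<Longrightarrow> x \<le> N"
    using T(1) unfolding finite_nat_set_iff_bounded_le by blast
  have "M \<le> card {x \<in> {1..n}. w x = a}" if "n \<ge> N" for n
  proof -
    have "T \<subseteq> {x \<in> {1..n}. w x = a}" using T(3) N that by (auto intro: le_trans)
    then have "card T \<le> card {x \<in> {1..n}. w x = a}" by (intro card_mono) simp_all
    then show ?thesis using T(2) by simp
  qed
  then show ?thesis unfolding eventually_sequentially by blast
qed

section \<open>Runs of consecutive positions\<close>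

text \<open>
  A graph of a word sees its set of positions only through the letters and through which positions are
  consecutive. Hence each maximal run of consecutive positions may be moved rigidly to another place,
  and the runs may be permuted, as long as distinct runs do not come to touch.
\<close>

definition consec :: "nat \<Rightarrow> nat \<Rightarrow> bool" where
  "consec x y \<longleftrightarrow> y = Suc x \<or> x = Suc y"

definition run_start :: "nat set \<Rightarrow> nat \<Rightarrow> nat" where
  "run_start J x = (LEAST a. {a..x} \<subseteq> J)"

lemma run_start:
  assumes "x \<in> J"
  shows "run_start J x \<le> x" "{run_start J x..x} \<subseteq> J" "run_start J x \<in> J"
proof -
  have x: "{x..x} \<subseteq> J" using assms by simp
  show 1: "run_start J x \<le> x" unfolding run_start_def using x by (rule Least_le)
  show 2: "{run_start J x..x} \<subseteq> J" unfolding run_start_def using x by (rule LeastI)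
  show "run_start J x \<in> J" using 1 2 by auto
qed

lemma run_start_le: "{a..x} \<subseteq> J \<Longrightarrow> run_start J x \<le> a"
  unfolding run_start_def by (rule Least_le)

lemma run_start_cong:
  assumes "x \<le> y" "{x..y} \<subseteq> J"
  shows "run_start J y = run_start J x"
proof (rule antisym)
  have x: "x \<in> J" and y: "y \<in> J" using assms by auto
  have "{run_start J x..y} \<subseteq> {run_start J x..x} \<union> {x..y}" using assms(1) by auto
  then show "run_start J y \<le> run_start J x"
    using run_start(2)[OF x] assms(2) by (intro run_start_le) blast
  have "{run_start J y..x} \<subseteq> {run_start J y..y}" using assms(1) by auto
  then show "run_start J x \<le> run_start J y"
    using run_start(2)[OF y] by (intro run_start_le) blast
qed

lemma run_start_idem: "x \<in> J \<Longrightarrow> run_start J (run_start J x) = run_start J x"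
  using run_start_cong[of "run_start J x" x J] run_start by simp

lemma consec_same_run:
  assumes "x \<in> J" "y \<in> J" "consec x y"
  shows "run_start J x = run_start J y"
proof -
  have "run_start J (Suc z) = run_start J z" if "z \<in> J" "Suc z \<in> J" for z
  proof (rule run_start_cong)
    have "{z..Suc z} = {z, Suc z}" by auto
    then show "{z..Suc z} \<subseteq> J" using that by simp
  qed simp
  then show ?thesis using assms unfolding consec_def by metis
qed

definition move_runs :: "nat set \<Rightarrow> (nat \<Rightarrow> nat) \<Rightarrow> nat \<Rightarrow> nat" where
  "move_runs J g x = g (run_start J x) + (x - run_start J x)"

lemma move_runs:
  assumes sep: "\<And>x y. x \<in> J \<Longrightarrow> y \<in> J \<Longrightarrow> run_start J x \<noteq> run_start J y \<Longrightarrow>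
      move_runs J g x \<noteq> move_runs J g y \<and> \<not> consec (move_runs J g x) (move_runs J g y)"
  shows move_runs_inj: "inj_on (move_runs J g) J"
    and move_runs_consec: "\<And>x y. x \<in> J \<Longrightarrow> y \<in> J \<Longrightarrow>
      consec (move_runs J g x) (move_runs J g y) \<longleftrightarrow> consec x y"
proof -
  have same: "(move_runs J g x = move_runs J g y \<longleftrightarrow> x = y) \<and>
      (consec (move_runs J g x) (move_runs J g y) \<longleftrightarrow> consec x y)"
    if "x \<in> J" "y \<in> J" "run_start J x = run_start J y" for x y
    using run_start(1)[OF that(1)] run_start(1)[OF that(2)] that(3)
    unfolding move_runs_def consec_def by auto
  show "inj_on (move_runs J g) J"
    by (rule inj_onI) (metis sep same)
  show "consec (move_runs J g x) (move_runs J g y) \<longleftrightarrow> consec x y" if "x \<in> J" "y \<in> J" for x y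
    by (metis sep same consec_same_run that)
qed

section \<open>Dickson's lemma\<close>

text \<open>
  The indices whose value is a minimum of the remaining tail are infinitely many, and along them the
  sequence is weakly increasing.
\<close>
lemma nat_mono_subseq:
  fixes f :: "nat \<Rightarrow> nat"
  obtains r :: "nat \<Rightarrow> nat" where "strict_mono r" "mono (f \<circ> r)"
proof -
  let ?S = "{x. \<forall>m\<ge>x. f x \<le> f m}"
  have "\<exists>x\<ge>N. x \<in> ?S" for N
  proof -
    obtain x where x: "x \<ge> N" "\<And>m. m \<ge> N \<Longrightarrow> f x \<le> f m"
      using ex_has_least_nat[of "\<lambda>m. m \<ge> N" N f] by auto
    then show ?thesis by (auto intro: exI[of _ x])
  qed
  then have inf: "infinite ?S" unfolding infinite_nat_iff_unbounded_le by blast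
  have sm: "strict_mono (enumerate ?S)" using inf by (rule strict_mono_enumerate)
  show ?thesis
  proof
    show "strict_mono (enumerate ?S)" by fact
    show "mono (f \<circ> enumerate ?S)"
    proof (rule monoI)
      fix i j :: nat assume "i \<le> j"
      then have "enumerate ?S i \<le> enumerate ?S j" using sm by (simp add: strict_mono_less_eq)
      then show "(f \<circ> enumerate ?S) i \<le> (f \<circ> enumerate ?S) j"
        using enumerate_in_set[OF inf, of i] by simp
    qed
  qed
qed

lemma dickson:
  fixes f :: "nat \<Rightarrow> 't \<Rightarrow> nat"
  assumes "finite T"
  shows "\<exists>r :: nat \<Rightarrow> nat. strict_mono r \<and> (\<forall>t\<in>T. \<forall>i j. i \<le> j \<longrightarrow> f (r i) t \<le> f (r j) t)"
proof -
  have "\<exists>r::nat \<Rightarrow> nat. strict_mono r \<and> (\<forall>t\<in>T. mono (\<lambda>i. f (r i) t))"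
    using assms
  proof (induction T)
    case empty
    show ?case by (auto intro: exI[of _ id] strict_mono_id)
  next
    case (insert t T)
    then obtain r :: "nat \<Rightarrow> nat" where r: "strict_mono r" "\<And>t. t \<in> T \<Longrightarrow> mono (\<lambda>i. f (r i) t)" by blast
    obtain s :: "nat \<Rightarrow> nat" where s: "strict_mono s" "mono ((\<lambda>i. f (r i) t) \<circ> s)"
      using nat_mono_subseq by blast
    have "mono (\<lambda>i. f ((r \<circ> s) i) u)" if "u \<in> T" for u
      using r(2)[OF that] s(1) by (auto simp: mono_def strict_mono_less_eq)
    then show ?case using r(1) s
      by (intro exI[of _ "r \<circ> s"]) (auto simp: o_def strict_mono_def)
  qed
  then show ?thesis by (simp add: mono_def)
qed

text \<open>
  If no type occurs more often in the first finite set than in the second, injections between the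
  fibres of the type maps can be glued.
\<close>
lemma type_preserving_injection:
  assumes "finite A" "finite B"
    and "\<And>a. a \<in> A \<Longrightarrow> card {x \<in> A. p x = p a} \<le> card {y \<in> B. q y = p a}"
  obtains g where "inj_on g A" "\<And>a. a \<in> A \<Longrightarrow> g a \<in> B \<and> q (g a) = p a"
proof -
  have "\<exists>h. inj_on h {x \<in> A. p x = t} \<and> h ` {x \<in> A. p x = t} \<subseteq> {y \<in> B. q y = t}" if t: "t \<in> p ` A" for t
  proof -
    obtain a where "a \<in> A" "t = p a" using t by blast
    then show ?thesis using assms by (intro inj_on_iff_card_le[THEN iffD2]) simp_all
  qed
  then obtain h where h: "\<And>t. t \<in> p ` A \<Longrightarrow> inj_on (h t) {x \<in> A. p x = t}"
      "\<And>t. t \<in> p ` A \<Longrightarrow> h t ` {x \<in> A. p x = t} \<subseteq> {y \<in> B. q y = t}"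
    using bchoice[of "p ` A" "\<lambda>t h. inj_on h {x \<in> A. p x = t} \<and> h ` {x \<in> A. p x = t} \<subseteq> {y \<in> B. q y = t}"] by blast
  define g where "g a = h (p a) a" for a
  have g: "g a \<in> B \<and> q (g a) = p a" if "a \<in> A" for a
    using h(2)[of "p a"] that unfolding g_def by auto
  moreover have "inj_on g A"
  proof (rule inj_onI)
    fix x y assume xy: "x \<in> A" "y \<in> A" "g x = g y"
    then have "p x = p y" using g by metis
    then show "x = y" using xy h(1)[of "p x"] unfolding g_def inj_on_def by auto
  qed
  ultimately show ?thesis using that by blast
qed

section \<open>Flipping adjacencies prescribed by letters\<close>

text \<open>
  Path-like and cyclic word graphs are both obtained from the adjacency prescribed by the letters by
  flipping it on the pairs of a sparse relation \<open>F\<close>: consecutive positions on a line or on a cycle.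
\<close>

definition flip_graph :: "('v \<times> 'v) set \<Rightarrow> (nat \<Rightarrow> 'v) \<Rightarrow> (nat \<Rightarrow> nat \<Rightarrow> bool) \<Rightarrow> nat set \<Rightarrow> ngraph" where
  "flip_graph E L F V =
     \<lparr>pverts = V, parcs = {(x, y). x \<in> V \<and> y \<in> V \<and> x \<noteq> y \<and> ((L x, L y) \<in> E) \<noteq> F x y}\<rparr>"

lemma flip_graph_simps [simp]:
  "pverts (flip_graph E L F V) = V"
  "(x, y) \<in> parcs (flip_graph E L F V) \<longleftrightarrow>
     x \<in> V \<and> y \<in> V \<and> x \<noteq> y \<and> ((L x, L y) \<in> E) \<noteq> F x y"
  by (auto simp: flip_graph_def)

lemma pair_wf_flip_graph [simp]: "pair_wf_digraph (flip_graph E L F V)"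
  by unfold_locales (auto simp: flip_graph_def)

lemma word_graph_eq: "word_graph w H I = flip_graph (parcs H) w consec I"
  unfolding word_graph_def flip_graph_def consec_def by (auto intro!: pair_pre_digraph.equality)

lemma induced_emb_flip_graph:
  assumes "inj_on \<phi> V" "\<phi> ` V \<subseteq> V'"
    and "\<And>x y. x \<in> V \<Longrightarrow> y \<in> V \<Longrightarrow> x \<noteq> y \<Longrightarrow> F' (\<phi> x) (\<phi> y) \<longleftrightarrow> F x y"
    and "\<And>x. x \<in> V \<Longrightarrow> L' (\<phi> x) = L x"
  shows "induced_emb \<phi> (flip_graph E L F V) (flip_graph E L' F' V')"
  unfolding induced_emb_def using assms by (auto simp: inj_on_eq_iff image_subset_iff)

section \<open>Recovering the flipped pairs from the graph\<close>

text \<open>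
  In a flip graph where \<open>F\<close> has bounded degree and every letter occurs often, the letters are determined
  by the graph up to twins (letters with equal neighbourhoods) and up to an automorphism of the letter
  graph modulo twins. Consequently every induced embedding between such graphs over one alphabet
  preserves \<open>F\<close>.
\<close>

lemma popular_value:
  assumes "finite S" "finite A" "f ` A \<subseteq> S" "card A > k * card S"
  shows "\<exists>b\<in>S. card {x \<in> A. f x = b} > k"
proof (rule ccontr)
  assume "\<not> ?thesis"
  then have le: "card {x \<in> A. f x = b} \<le> k" if "b \<in> S" for b using that by auto
  have "A = (\<Union>b\<in>S. {x \<in> A. f x = b})" using assms(3) by auto
  then have "card A \<le> (\<Sum>b\<in>S. card {x \<in> A. f x = b})"
    using card_UN_le[OF assms(1), of "\<lambda>b. {x \<in> A. f x = b}"] by simp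
  also have "\<dots> \<le> card S * k" using sum_bounded_above[of S _ k] le by simp
  finally show False using assms(4) by (simp add: mult.commute)
qed

text \<open>
  Here \<open>L\<close> and \<open>L'\<close> are two letterings of the same vertices that prescribe the same adjacency between
  each vertex and all but \<open>k\<close> others; they must then agree everywhere. By pigeonhole every letter \<open>a\<close>
  has a letter \<open>f a\<close> that replaces it more than \<open>k\<close> times, and such a majority fixes all adjacencies to
  it. So \<open>f\<close> preserves and reflects adjacency, hence is injective on twin classes, hence, the alphabet
  being finite, meets every twin class. The new letter of any vertex of letter \<open>a\<close> can therefore be
  tested against all letters by means of majorities, and turns out to be a twin of \<open>f a\<close>.
\<close>
lemma letters_recovered:
  fixes E :: "('v \<times> 'v) set"
  assumes sym: "\<And>a b. (a, b) \<in> E \<Longrightarrow> (b, a) \<in> E"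
    and fin: "finite \<Sigma>" "finite V"
    and L: "\<And>x. x \<in> V \<Longrightarrow> L x \<in> \<Sigma>" and L': "\<And>x. x \<in> V \<Longrightarrow> L' x \<in> \<Sigma>"
    and many: "\<And>a. a \<in> \<Sigma> \<Longrightarrow> card {x \<in> V. L x = a} > k * card \<Sigma>"
    and few: "\<And>x. x \<in> V \<Longrightarrow> card {y \<in> V. ((L x, L y) \<in> E) \<noteq> ((L' x, L' y) \<in> E)} \<le> k"
    and x: "x \<in> V" and y: "y \<in> V"
  shows "(L x, L y) \<in> E \<longleftrightarrow> (L' x, L' y) \<in> E"
proof -
  have "\<exists>b\<in>\<Sigma>. card {z \<in> V. L z = a \<and> L' z = b} > k" if a: "a \<in> \<Sigma>" for a
    using popular_value[of \<Sigma> "{z \<in> V. L z = a}" L' k] fin many[OF a] L' by auto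
  then obtain f where f: "\<And>a. a \<in> \<Sigma> \<Longrightarrow> f a \<in> \<Sigma>"
      "\<And>a. a \<in> \<Sigma> \<Longrightarrow> card {z \<in> V. L z = a \<and> L' z = f a} > k"
    by metis
  have agree: "(L z, a) \<in> E \<longleftrightarrow> (L' z, f a) \<in> E" if z: "z \<in> V" and a: "a \<in> \<Sigma>" for z a
  proof (rule ccontr)
    assume "\<not> ?thesis"
    then have "{u \<in> V. L u = a \<and> L' u = f a} \<subseteq> {u \<in> V. ((L z, L u) \<in> E) \<noteq> ((L' z, L' u) \<in> E)}"
      by auto
    then have "card {u \<in> V. L u = a \<and> L' u = f a} \<le> card {u \<in> V. ((L z, L u) \<in> E) \<noteq> ((L' z, L' u) \<in> E)}"
      by (rule card_mono[rotated]) (simp add: fin(2))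
    also have "\<dots> \<le> k" using few[OF z] .
    finally have "card {u \<in> V. L u = a \<and> L' u = f a} \<le> k" .
    then show False using f(2)[OF a] by simp
  qed
  have hom: "(a, b) \<in> E \<longleftrightarrow> (f a, f b) \<in> E" if a: "a \<in> \<Sigma>" and b: "b \<in> \<Sigma>" for a b
  proof -
    have "{z \<in> V. L z = a \<and> L' z = f a} \<noteq> {}" using f(2)[OF a] by (metis card.empty not_less_zero)
    then obtain z where "z \<in> V" "L z = a" "L' z = f a" by blast
    then show ?thesis using agree[of z b] b by simp
  qed
  \<comment> \<open>Two letters are twins iff they have the same row.\<close>
  define row where "row a = {c \<in> \<Sigma>. (a, c) \<in> E}" for a
  have cancel: "row a = row b" if ab: "a \<in> \<Sigma>" "b \<in> \<Sigma>" and eq: "row (f a) = row (f b)" for a b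
  proof -
    have "(a, c) \<in> E \<longleftrightarrow> (b, c) \<in> E" if c: "c \<in> \<Sigma>" for c
      using hom[OF ab(1) c] hom[OF ab(2) c] f(1)[OF c] eq unfolding row_def by blast
    then show ?thesis unfolding row_def by auto
  qed
  define h where "h r = row (inv_into \<Sigma> (\<lambda>a. row (f a)) r)" for r
  have h: "h (row (f a)) = row a" if a: "a \<in> \<Sigma>" for a
    unfolding h_def
  proof (rule cancel)
    have i: "row (f a) \<in> (\<lambda>a. row (f a)) ` \<Sigma>" using a by blast
    show "inv_into \<Sigma> (\<lambda>a. row (f a)) (row (f a)) \<in> \<Sigma>" using i by (rule inv_into_into)
    show "row (f (inv_into \<Sigma> (\<lambda>a. row (f a)) (row (f a)))) = row (f a)" using i by (rule f_inv_into_f)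
  qed (rule a)
  have "row ` \<Sigma> \<subseteq> h ` ((\<lambda>a. row (f a)) ` \<Sigma>)" using h by force
  then have "card (row ` \<Sigma>) \<le> card ((\<lambda>a. row (f a)) ` \<Sigma>)"
    using fin(1) by (meson card_image_le card_mono finite_imageI le_trans)
  moreover have "(\<lambda>a. row (f a)) ` \<Sigma> \<subseteq> row ` \<Sigma>" using f(1) by auto
  ultimately have rows: "(\<lambda>a. row (f a)) ` \<Sigma> = row ` \<Sigma>"
    using fin(1) by (intro card_seteq) auto
  have twin: "row (L' z) = row (f (L z))" if z: "z \<in> V" for z
  proof -
    have "(L' z, c) \<in> E \<longleftrightarrow> (f (L z), c) \<in> E" if c: "c \<in> \<Sigma>" for c
    proof -
      obtain d where d: "d \<in> \<Sigma>" "row c = row (f d)" using rows c by blast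
      have sw: "(e, c) \<in> E \<longleftrightarrow> (e, f d) \<in> E" if "e \<in> \<Sigma>" for e
        using d(2) sym that unfolding row_def by blast
      show ?thesis
        using sw[OF L'[OF z]] sw[OF f(1)[OF L[OF z]]] agree[OF z d(1)] hom[OF L[OF z] d(1)] by simp
    qed
    then show ?thesis unfolding row_def by auto
  qed
  have tw: "(L' z, c) \<in> E \<longleftrightarrow> (f (L z), c) \<in> E" if "z \<in> V" "c \<in> \<Sigma>" for z c
    using twin[OF that(1)] that(2) unfolding row_def by blast
  have "(L' x, L' y) \<in> E \<longleftrightarrow> (f (L x), L' y) \<in> E" using tw[OF x L'[OF y]] .
  also have "\<dots> \<longleftrightarrow> (L' y, f (L x)) \<in> E" using sym by blast
  also have "\<dots> \<longleftrightarrow> (f (L y), f (L x)) \<in> E" using tw[OF y f(1)[OF L[OF x]]] .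
  also have "\<dots> \<longleftrightarrow> (L y, L x) \<in> E" using hom[OF L[OF y] L[OF x]] by simp
  also have "\<dots> \<longleftrightarrow> (L x, L y) \<in> E" using sym by blast
  finally show ?thesis by simp
qed

text \<open>
  Pull the lettering of the target back along the embedding and compare it with the lettering of the
  source. At a vertex \<open>x\<close> the two can disagree only at \<open>x\<close> itself, at its at most two flipped partners,
  and at the preimages of the at most two flipped partners of its image; hence the constant 5.
\<close>
lemma flips_preserved:
  assumes sym: "\<And>a b. (a, b) \<in> E \<Longrightarrow> (b, a) \<in> E"
    and fin: "finite \<Sigma>" "finite V"
    and L: "\<And>x. x \<in> V \<Longrightarrow> L x \<in> \<Sigma>" and L': "\<And>x. x \<in> V' \<Longrightarrow> L' x \<in> \<Sigma>"
    and many: "\<And>a. a \<in> \<Sigma> \<Longrightarrow> card {x \<in> V. L x = a} > 5 * card \<Sigma>"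
    and deg: "\<And>x. x \<in> V \<Longrightarrow> card {y \<in> V. F x y} \<le> 2"
    and deg': "\<And>x. x \<in> V' \<Longrightarrow> card {y \<in> V'. F' x y} \<le> 2" and fin': "finite V'"
    and induced_emb: "induced_emb \<phi> (flip_graph E L F V) (flip_graph E L' F' V')"
    and xy: "x \<in> V" "y \<in> V" "x \<noteq> y"
  shows "F' (\<phi> x) (\<phi> y) \<longleftrightarrow> F x y"
proof -
  have inj: "inj_on \<phi> V" and im: "\<And>x. x \<in> V \<Longrightarrow> \<phi> x \<in> V'" using induced_emb unfolding induced_emb_def by auto
  have adj: "((L x, L y) \<in> E) \<noteq> F x y \<longleftrightarrow> ((L' (\<phi> x), L' (\<phi> y)) \<in> E) \<noteq> F' (\<phi> x) (\<phi> y)"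
    if "x \<in> V" "y \<in> V" "x \<noteq> y" for x y
    using induced_emb that im inj unfolding induced_emb_def by (auto simp: inj_on_eq_iff)
  have few: "card {y \<in> V. ((L x, L y) \<in> E) \<noteq> ((L' (\<phi> x), L' (\<phi> y)) \<in> E)} \<le> 5" if x: "x \<in> V" for x
  proof -
    let ?A = "{y \<in> V. F x y}" and ?B = "{y \<in> V. F' (\<phi> x) (\<phi> y)}"
    have "card ?B = card (\<phi> ` ?B)" using inj by (intro card_image[symmetric] inj_on_subset[OF inj]) auto
    also have "\<dots> \<le> card {y \<in> V'. F' (\<phi> x) y}" using im fin' by (intro card_mono) auto
    also have "\<dots> \<le> 2" using deg' im x by blast
    finally have B: "card ?B \<le> 2" .
    have "card {y \<in> V. ((L x, L y) \<in> E) \<noteq> ((L' (\<phi> x), L' (\<phi> y)) \<in> E)} \<le> card ({x} \<union> (?A \<union> ?B))"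
      using adj[OF x] fin(2) by (intro card_mono) auto
    also have "\<dots> \<le> card {x} + (card ?A + card ?B)"
      by (meson add_left_mono card_Un_le le_trans)
    also have "\<dots> \<le> 5" using B deg[OF x] by simp
    finally show ?thesis .
  qed
  have "(L x, L y) \<in> E \<longleftrightarrow> (L' (\<phi> x), L' (\<phi> y)) \<in> E"
    using letters_recovered[OF sym fin, of L "\<lambda>x. L' (\<phi> x)" 5] L L' im many few xy by blast
  then show ?thesis using adj[OF xy] by blast
qed

section \<open>Cyclic adjacency\<close>

definition cyclic :: "nat \<Rightarrow> nat \<Rightarrow> nat \<Rightarrow> bool" where
  "cyclic n x y \<longleftrightarrow> consec x y \<or> x = 1 \<and> y = n \<or> x = n \<and> y = 1"

definition cyc_next :: "nat \<Rightarrow> nat \<Rightarrow> nat" where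
  "cyc_next n x = (if x = n then 1 else Suc x)"

definition cyc_prev :: "nat \<Rightarrow> nat \<Rightarrow> nat" where
  "cyc_prev n x = (if x = 1 then n else x - 1)"

lemma cyclic_neighbours:
  assumes "n \<ge> 3" "x \<in> {1..n}"
  shows "{y \<in> {1..n}. cyclic n x y} = {cyc_next n x, cyc_prev n x}" "cyc_next n x \<noteq> cyc_prev n x"
    "cyc_next n x \<noteq> x" "cyc_prev n x \<noteq> x"
proof -
  have x: "1 \<le> x" "x \<le> n" using assms(2) by simp_all
  have "cyclic n x y \<longleftrightarrow> y = cyc_next n x \<or> y = cyc_prev n x" if "1 \<le> y" "y \<le> n" for y
  proof -
    consider "x = 1" | "x = n" "x \<noteq> 1" | "x \<noteq> 1" "x \<noteq> n" by blast
    then show ?thesis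
      using assms(1) x that unfolding cyclic_def cyc_next_def cyc_prev_def consec_def
      by cases (simp; linarith)+
  qed
  moreover have "cyc_next n x \<in> {1..n}" "cyc_prev n x \<in> {1..n}"
    using assms(1) x unfolding cyc_next_def cyc_prev_def by auto
  ultimately show "{y \<in> {1..n}. cyclic n x y} = {cyc_next n x, cyc_prev n x}"
    by (auto simp del: One_nat_def)
  show "cyc_next n x \<noteq> cyc_prev n x" "cyc_next n x \<noteq> x" "cyc_prev n x \<noteq> x"
    using assms(1) x unfolding cyc_next_def cyc_prev_def by auto
qed

lemma cyclic_degree:
  assumes "n \<ge> 3" "x \<in> {1..n}"
  shows "card {y \<in> {1..n}. cyclic n x y} = 2"
  using cyclic_neighbours[OF assms] by simp

text \<open>
  Every vertex of a cycle has degree two, so the image of a cycle under an induced embedding is closed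
  under taking neighbours in the target cycle, and is therefore all of it.
\<close>
lemma cycle_in_cycle:
  assumes mn: "m \<ge> 3" "n \<ge> 3"
    and inj: "inj_on \<phi> {1..m}" and im: "\<phi> ` {1..m} \<subseteq> {1..n}"
    and pres: "\<And>x y. x \<in> {1..m} \<Longrightarrow> y \<in> {1..m} \<Longrightarrow> x \<noteq> y \<Longrightarrow> cyclic n (\<phi> x) (\<phi> y) \<longleftrightarrow> cyclic m x y"
  shows "m = n"
proof -
  let ?S = "\<phi> ` {1..m}"
  have closed: "cyc_next n z \<in> ?S" if z: "z \<in> ?S" for z
  proof -
    obtain x where x: "x \<in> {1..m}" "z = \<phi> x" using z by blast
    have zn: "z \<in> {1..n}" using z im by blast
    let ?N = "{y \<in> {1..m}. cyclic m x y}"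
    have "y \<noteq> x" if y: "y \<in> ?N" for y
    proof -
      have "y = cyc_next m x \<or> y = cyc_prev m x"
        using y unfolding cyclic_neighbours(1)[OF mn(1) x(1)] by simp
      then show ?thesis using cyclic_neighbours(3,4)[OF mn(1) x(1)] by metis
    qed
    then have sub: "\<phi> ` ?N \<subseteq> {y \<in> {1..n}. cyclic n z y}"
      using pres[OF x(1)] im x(2) by fastforce
    have "card (\<phi> ` ?N) = card ?N" by (rule card_image, rule inj_on_subset[OF inj]) auto
    then have "card (\<phi> ` ?N) = 2" using cyclic_degree[OF mn(1) x(1)] by simp
    then have "\<phi> ` ?N = {y \<in> {1..n}. cyclic n z y}"
      using sub cyclic_degree[OF mn(2) zn] by (intro card_subset_eq) auto
    then have "cyc_next n z \<in> \<phi> ` ?N" using cyclic_neighbours(1)[OF mn(2) zn] by blast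
    then show ?thesis by blast
  qed
  have up: "z + i \<in> ?S" if "z \<in> ?S" "z + i \<le> n" for z i
    using that(2)
  proof (induction i)
    case 0 then show ?case using that(1) by simp
  next
    case (Suc i)
    then show ?case using closed[of "z + i"] by (simp add: cyc_next_def)
  qed
  have one_S: "\<phi> 1 \<in> ?S" using mn(1) by simp
  moreover have "\<phi> 1 \<le> n" using im one_S by (meson atLeastAtMost_iff subsetD)
  ultimately have "n \<in> ?S" using up[of "\<phi> 1" "n - \<phi> 1"] by simp
  then have one: "1 \<in> ?S" using closed[of n] by (simp add: cyc_next_def)
  have "{1..n} \<subseteq> ?S"
  proof
    fix z assume "z \<in> {1..n}"
    then show "z \<in> ?S" using up[OF one, of "z - 1"] by simp
  qed
  then have "?S = {1..n}" using im by blast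
  then show ?thesis using card_image[OF inj] by simp
qed

section \<open>The word class as an age\<close>

text \<open>
  The word class consists of the finite graphs that embed into the single infinite graph on all
  positions. This removes the choice of a set of positions from the definition.
\<close>

lemma word_class_iff:
  "K \<in> word_class w H \<longleftrightarrow>
     pair_wf_digraph K \<and> finite (pverts K) \<and> (\<exists>f. induced_emb f K (word_graph w H {1..}))"
proof
  assume "K \<in> word_class w H"
  then obtain I where I: "finite I" "I \<subseteq> {1..}"
    and iso: "digraph_iso (with_proj (word_graph w H I)) (with_proj K)"
    unfolding word_class_def by blast
  have wf: "pair_wf_digraph (word_graph w H I)" by (simp add: word_graph_eq)
  obtain f where K: "pair_wf_digraph K" and f: "induced_emb f (word_graph w H I) K"
      "f ` pverts (word_graph w H I) = pverts K"
    using iso digraph_iso_iff[OF wf] by blast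
  obtain h where h: "induced_emb h K (word_graph w H I)" using induced_emb_inverse[OF f] by blast
  have "induced_emb id (word_graph w H I) (word_graph w H {1..})"
    unfolding word_graph_eq by (rule induced_emb_flip_graph) (use I in auto)
  then have "induced_emb (id \<circ> h) K (word_graph w H {1..})" by (rule induced_emb_trans[OF h])
  moreover have "finite (pverts K)"
    unfolding f(2)[symmetric] using I(1) by (simp add: word_graph_eq)
  ultimately show "pair_wf_digraph K \<and> finite (pverts K) \<and> (\<exists>f. induced_emb f K (word_graph w H {1..}))"
    using K by blast
next
  assume "pair_wf_digraph K \<and> finite (pverts K) \<and> (\<exists>f. induced_emb f K (word_graph w H {1..}))"
  then obtain f where K: "pair_wf_digraph K" "finite (pverts K)"
    and f: "induced_emb f K (word_graph w H {1..})" by blast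
  let ?I = "f ` pverts K"
  have I: "?I \<subseteq> {1..}" using f unfolding induced_emb_def word_graph_eq by simp
  have "induced_emb f K (word_graph w H ?I)"
    using f I unfolding induced_emb_def word_graph_eq by (simp add: subset_iff)
  then obtain h where "induced_emb h (word_graph w H ?I) K" "h ` pverts (word_graph w H ?I) = pverts K"
    by (rule induced_emb_inverse) (simp_all add: word_graph_eq)
  then have "digraph_iso (with_proj (word_graph w H ?I)) (with_proj K)"
    using K(1) digraph_iso_iff[of "word_graph w H ?I" K] by (auto simp: word_graph_eq)
  then show "K \<in> word_class w H"
    using K(2) I unfolding word_class_def by blast
qed

lemma graph_class_word_class:
  assumes sym: "\<And>a b. (a, b) \<in> parcs H \<Longrightarrow> (b, a) \<in> parcs H"
  shows "graph_class (word_class w H)"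
proof (rule graph_classI)
  fix G assume "G \<in> word_class w H"
  then obtain f where G: "pair_wf_digraph G" "finite (pverts G)" "induced_emb f G (word_graph w H {1..})"
    unfolding word_class_iff by blast
  show "pair_graph G"
    using G(3,1,2)
  proof (rule induced_emb_pair_graph)
    fix x y assume "(x, y) \<in> parcs (word_graph w H {1..})"
    then show "(y, x) \<in> parcs (word_graph w H {1..})"
      using sym unfolding word_graph_eq by (auto simp: consec_def)
  qed (simp add: word_graph_eq)
next
  fix G K f
  assume K: "K \<in> word_class w H" and G: "pair_wf_digraph G" and f: "induced_emb f G K"
  obtain g where "finite (pverts K)" "induced_emb g K (word_graph w H {1..})"
    using K unfolding word_class_iff by blast
  then have "induced_emb (g \<circ> f) G (word_graph w H {1..})"
    using induced_emb_trans[OF f] by blast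
  moreover have "finite (pverts G)"
    using f \<open>finite (pverts K)\<close> unfolding induced_emb_def by (meson finite_imageD finite_subset)
  ultimately show "G \<in> word_class w H" using G unfolding word_class_iff by blast
qed

section \<open>The word class is a limit class\<close>

text \<open>
  The classes approximating the word class from above consist of the graphs whose induced subgraphs on
  at most \<open>k\<close> vertices belong to it. Cyclic word graphs provide the infinite antichains.
\<close>

definition local_class :: "ngraph set \<Rightarrow> nat \<Rightarrow> ngraph set" where
  "local_class C k = {K. pair_graph K \<and> (\<forall>S\<subseteq>pverts K. card S \<le> k \<longrightarrow> induce K S \<in> C)}"

lemma graph_class_local_class:
  assumes C: "graph_class C"
  shows "graph_class (local_class C k)"
proof (rule graph_classI)
  fix G K f
  assume K: "K \<in> local_class C k" and G: "pair_wf_digraph G" and f: "induced_emb f G K"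
  have pK: "pair_graph K" using K unfolding local_class_def by blast
  have inj: "inj_on f (pverts G)" and im: "f ` pverts G \<subseteq> pverts K" using f unfolding induced_emb_def by auto
  have "finite (pverts G)"
    using inj im pK unfolding pair_graph_iff by (meson finite_imageD finite_subset)
  then have "pair_graph G"
    using pK f G by (intro induced_emb_pair_graph[of f G K]) (auto simp: pair_graph_iff)
  moreover have "induce G S \<in> C" if S: "S \<subseteq> pverts G" "card S \<le> k" for S
  proof -
    have "card (f ` S) \<le> k" using S inj by (metis card_image inj_on_subset)
    moreover have "f ` S \<subseteq> pverts K" using S(1) im by blast
    ultimately have "induce K (f ` S) \<in> C" using K unfolding local_class_def by blast
    then show ?thesis
      using graph_class_down[OF C _ pair_wf_induce induced_emb_induce_induce[OF f S(1) subset_refl]] by blast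
  qed
  ultimately show "G \<in> local_class C k" unfolding local_class_def by blast
qed (simp add: local_class_def)

lemma local_class_Suc: "local_class C (Suc k) \<subseteq> local_class C k"
  unfolding local_class_def by auto

lemma Inter_local_class:
  assumes C: "graph_class C"
  shows "(\<Inter>k. local_class C k) = C"
proof (intro equalityI subsetI)
  fix K assume K: "K \<in> (\<Inter>k. local_class C k)"
  then have "K \<in> local_class C (card (pverts K))" by blast
  then have "pair_graph K" and "induce K (pverts K) \<in> C"
    unfolding local_class_def by auto
  moreover have "induced_emb id K (induce K (pverts K))" unfolding induced_emb_def by simp
  ultimately show "K \<in> C" using graph_class_down[OF C] pair_graph_wf by blast
next
  fix K assume K: "K \<in> C"
  then have "pair_graph K" using C unfolding graph_class_def by blast
  moreover have "induce K S \<in> C" if "S \<subseteq> pverts K" for S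
    using graph_class_down[OF C K pair_wf_induce induced_emb_induce[OF that]] .
  ultimately show "K \<in> (\<Inter>k. local_class C k)" unfolding local_class_def by blast
qed

text \<open>
  By recurrence, each run occurs in \<open>w\<close> arbitrarily far out, so the runs can be placed from left to
  right with gaps.
\<close>
lemma place_runs:
  assumes w: "almost_periodic w" and J: "finite J"
    and run: "\<And>a. a \<in> J \<Longrightarrow> \<exists>b\<ge>1. \<forall>i. {a..a + i} \<subseteq> J \<longrightarrow> L (a + i) = w (b + i)"
  obtains \<psi> where "inj_on \<psi> J" "\<psi> ` J \<subseteq> {1..}"
    "\<And>x y. x \<in> J \<Longrightarrow> y \<in> J \<Longrightarrow> consec (\<psi> x) (\<psi> y) \<longleftrightarrow> consec x y"
    "\<And>x. x \<in> J \<Longrightarrow> w (\<psi> x) = L x"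
proof -
  obtain m where m: "\<And>x. x \<in> J \<Longrightarrow> x < m"
    using J unfolding finite_nat_set_iff_bounded by blast
  \<comment> \<open>\<open>Q a p\<close>: whatever run of \<open>J\<close> starts at \<open>a\<close>, its letters can be read in \<open>w\<close> from position \<open>p\<close> on.\<close>
  define Q where "Q a p \<longleftrightarrow> p \<ge> 1 \<and> (\<forall>i<m. {a..a + i} \<subseteq> J \<longrightarrow> w (p + i) = L (a + i))" for a p
  have Q: "\<exists>p>B. Q a p" for a B
  proof (cases "a \<in> J")
    case True
    then obtain b where b: "b \<ge> 1" "\<And>i. {a..a + i} \<subseteq> J \<Longrightarrow> L (a + i) = w (b + i)"
      using run by blast
    obtain p where "p > B" "\<forall>i<m. w (p + i) = w (b + i)"
      using almost_periodic_recurrent[OF w b(1)] by blast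
    then show ?thesis using b(2) unfolding Q_def by (intro exI[of _ p]) auto
  next
    case False
    have "\<not> {a..a + i} \<subseteq> J" for i
      using False by (metis atLeastAtMost_iff le_add1 order_refl subsetD)
    then show ?thesis unfolding Q_def by (intro exI[of _ "Suc B"]) auto
  qed
  have "\<exists>g. \<forall>a. Q a (g a) \<and> g (Suc a) > g a + m"
    by (rule dependent_nat_choice) (use Q in blast)+
  then obtain g where g: "\<And>a. Q a (g a)" "\<And>a. g (Suc a) > g a + m" by blast
  have gap: "g a + m < g b" if "a < b" for a b
    using that by (induction rule: less_Suc_induct) (use g(2) in \<open>auto intro: less_trans\<close>)
  let ?\<psi> = "move_runs J g"
  have pos: "g (run_start J x) \<le> ?\<psi> x \<and> ?\<psi> x < g (run_start J x) + m" if "x \<in> J" for x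
    using m[OF that] by (auto simp: move_runs_def)
  have far: "Suc (?\<psi> x) < ?\<psi> y" if "x \<in> J" "y \<in> J" "run_start J x < run_start J y" for x y
    using pos[OF that(1)] pos[OF that(2)] gap[OF that(3)] by linarith
  have sep: "?\<psi> x \<noteq> ?\<psi> y \<and> \<not> consec (?\<psi> x) (?\<psi> y)"
    if "x \<in> J" "y \<in> J" "run_start J x \<noteq> run_start J y" for x y
    using far[OF that(1,2)] far[OF that(2,1)] that(3) unfolding consec_def
    by (metis Suc_lessD less_irrefl nat_neq_iff)
  show ?thesis
  proof
    show "inj_on ?\<psi> J" using sep by (rule move_runs_inj)
    show "consec (?\<psi> x) (?\<psi> y) \<longleftrightarrow> consec x y" if "x \<in> J" "y \<in> J" for x y
      using sep that by (rule move_runs_consec)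
    have "?\<psi> x \<ge> 1" if "x \<in> J" for x
      using pos[OF that] g(1)[of "run_start J x"] unfolding Q_def by linarith
    then show "?\<psi> ` J \<subseteq> {1..}" by auto
    show "w (?\<psi> x) = L x" if x: "x \<in> J" for x
    proof -
      let ?s = "run_start J x"
      have s: "?s + (x - ?s) = x" using run_start(1)[OF x] by simp
      have "x - ?s < m" using m[OF x] by simp
      moreover have "{?s..?s + (x - ?s)} \<subseteq> J" unfolding s by (rule run_start(2)[OF x])
      ultimately have "w (g ?s + (x - ?s)) = L (?s + (x - ?s))"
        using g(1)[of ?s] unfolding Q_def by blast
      then show ?thesis unfolding s move_runs_def .
    qed
  qed
qed

definition cyclic_word_graph :: "(nat \<Rightarrow> 'v) \<Rightarrow> 'v pair_pre_digraph \<Rightarrow> nat \<Rightarrow> ngraph" where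
  "cyclic_word_graph w H n = flip_graph (parcs H) w (cyclic n) {1..n}"

text \<open>
  A set of at most \<open>k\<close> vertices misses a vertex \<open>t\<close> of the cycle. Cutting the cycle at \<open>t\<close> unrolls the
  set into positions of the word \<open>w\<^sub>1 \<dots> w\<^sub>n w\<^sub>1 \<dots> w\<^sub>n\<close>. Its runs have length at most \<open>k\<close>; since the
  prefix of length \<open>k\<close> of \<open>w\<close> recurs at position \<open>n + 1\<close>, even a run across the seam is a factor of \<open>w\<close>.
\<close>
lemma cyclic_word_graph_local:
  assumes sym: "\<And>a b. (a, b) \<in> parcs H \<Longrightarrow> (b, a) \<in> parcs H"
    and w: "almost_periodic w" and kn: "k < n"
    and per: "\<And>i. i < k \<Longrightarrow> w (Suc n + i) = w (1 + i)"
  shows "cyclic_word_graph w H n \<in> local_class (word_class w H) k"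
proof -
  let ?G = "cyclic_word_graph w H n"
  have "pair_graph ?G"
    using sym unfolding pair_graph_iff cyclic_word_graph_def
    by (auto simp: cyclic_def consec_def)
  moreover have "induce ?G S \<in> word_class w H" if S: "S \<subseteq> {1..n}" "card S \<le> k" for S
  proof -
    have finS: "finite S" using S(1) finite_subset by blast
    have "S \<noteq> {1..n}" using S(2) kn by auto
    then obtain t where "t \<in> {1..n}" "t \<notin> S" using S(1) by blast
    then have t: "1 \<le> t" "t \<le> n" "t \<notin> S" by simp_all
    define u where "u x = (if x > t then x else x + n)" for x
    define L where "L z = (if z \<le> n then w z else w (z - n))" for z
    let ?J = "u ` S"
    have Sx: "1 \<le> x \<and> x \<le> n \<and> x \<noteq> t" if "x \<in> S" for x using that S(1) t(3) by auto
    have inj_u: "inj_on u S"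
      unfolding u_def by (rule inj_onI) (auto dest!: Sx split: if_splits)
    have cyc: "consec (u x) (u y) \<longleftrightarrow> cyclic n x y" if "x \<in> S" "y \<in> S" for x y
      using Sx[OF that(1)] Sx[OF that(2)] t(1,2) unfolding u_def cyclic_def consec_def
      by (cases "x > t"; cases "y > t"; simp; linarith)
    have Lu: "L (u x) = w x" if "x \<in> S" for x
      using Sx[OF that] t unfolding L_def u_def by auto
    have run: "\<exists>b\<ge>1. \<forall>i. {a..a + i} \<subseteq> ?J \<longrightarrow> L (a + i) = w (b + i)" if a: "a \<in> ?J" for a
    proof -
      have len: "i < k" if "{a..a + i} \<subseteq> ?J" for i
      proof -
        have "card {a..a + i} \<le> card ?J" using finS that by (intro card_mono) auto
        also have "\<dots> \<le> k" using card_image_le[OF finS, of u] S(2) by linarith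
        finally show ?thesis by simp
      qed
      have a1: "1 \<le> a" using a Sx unfolding u_def by fastforce
      show ?thesis
      proof (cases "a \<le> n")
        case True
        have "L (a + i) = w (a + i)" if "{a..a + i} \<subseteq> ?J" for i
        proof (cases "a + i \<le> n")
          case False
          then have "a + i - Suc n < k" "Suc n + (a + i - Suc n) = a + i" "1 + (a + i - Suc n) = a + i - n"
            using len[OF that] True by simp_all
          then show ?thesis using per[of "a + i - Suc n"] False unfolding L_def by simp
        qed (simp add: L_def)
        then show ?thesis using a1 by blast
      next
        case False
        then have "L (a + i) = w (a - n + i)" for i unfolding L_def by simp
        then show ?thesis using False by (intro exI[of _ "a - n"]) simp
      qed
    qed
    have finJ: "finite ?J" using finS by simp
    obtain \<psi> where psi: "inj_on \<psi> ?J" "\<psi> ` ?J \<subseteq> {1..}"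
      "\<And>x y. x \<in> ?J \<Longrightarrow> y \<in> ?J \<Longrightarrow> consec (\<psi> x) (\<psi> y) \<longleftrightarrow> consec x y"
      "\<And>x. x \<in> ?J \<Longrightarrow> w (\<psi> x) = L x"
      using place_runs[OF w finJ run] by blast
    have "induced_emb (\<psi> \<circ> u) (flip_graph (parcs H) w (cyclic n) S) (word_graph w H {1..})"
      unfolding word_graph_eq
    proof (rule induced_emb_flip_graph)
      show "inj_on (\<psi> \<circ> u) S" using inj_u psi(1) by (rule comp_inj_on)
      show "(\<psi> \<circ> u) ` S \<subseteq> {1..}" using psi(2) by (simp add: image_comp)
    qed (use psi(3,4) cyc Lu in auto)
    moreover have "induce ?G S = flip_graph (parcs H) w (cyclic n) S"
      unfolding cyclic_word_graph_def induce_def flip_graph_def using S(1) by auto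
    ultimately show ?thesis using finS unfolding word_class_iff by auto
  qed
  ultimately show ?thesis unfolding local_class_def by (simp add: cyclic_word_graph_def)
qed

lemma cyclic_word_graphs_incomparable:
  assumes sym: "\<And>a b. (a, b) \<in> parcs H \<Longrightarrow> (b, a) \<in> parcs H"
    and fin: "finite (w ` {1..})"
    and mn: "3 \<le> m" "3 \<le> n"
    and many: "\<And>a. a \<in> w ` {1..} \<Longrightarrow> 5 * card (w ` {1..}) < card {x \<in> {1..m}. w x = a}"
    and f: "induced_emb f (cyclic_word_graph w H m) (cyclic_word_graph w H n)"
  shows "m = n"
proof (rule cycle_in_cycle[OF mn])
  show "inj_on f {1..m}" "f ` {1..m} \<subseteq> {1..n}"
    using f unfolding induced_emb_def cyclic_word_graph_def by simp_all
  fix x y assume xy: "x \<in> {1..m}" "y \<in> {1..m}" "x \<noteq> y"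
  show "cyclic n (f x) (f y) \<longleftrightarrow> cyclic m x y"
    by (rule flips_preserved[OF sym fin _ _ _ many _ _ _ f[unfolded cyclic_word_graph_def] xy])
      (use mn cyclic_degree in auto)
qed

lemma local_word_class_not_wqo:
  assumes sym: "\<And>a b. (a, b) \<in> parcs H \<Longrightarrow> (b, a) \<in> parcs H"
    and fin: "finite (w ` {1..})" and w: "almost_periodic w"
  shows "\<not> well_quasi_ordered (local_class (word_class w H) k)"
proof -
  let ?\<Sigma> = "w ` {1..}"
  have "\<forall>\<^sub>F n in sequentially. Suc (5 * card ?\<Sigma>) \<le> card {x \<in> {1..n}. w x = a}" if "a \<in> ?\<Sigma>" for a
    using letter_frequent[OF w that] .
  then have "\<forall>\<^sub>F n in sequentially. \<forall>a\<in>?\<Sigma>. Suc (5 * card ?\<Sigma>) \<le> card {x \<in> {1..n}. w x = a}"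
    using fin by (intro eventually_ball_finite) blast+
  then obtain N where N: "\<And>n a. n \<ge> N \<Longrightarrow> a \<in> ?\<Sigma> \<Longrightarrow> 5 * card ?\<Sigma> < card {x \<in> {1..n}. w x = a}"
    unfolding eventually_sequentially Suc_le_eq by blast
  define S where "S = {n. n \<ge> N \<and> k < n \<and> 3 \<le> n \<and> (\<forall>i<k. w (Suc n + i) = w (1 + i))}"
  have "\<exists>n>B. n \<in> S" for B
  proof -
    obtain p where p: "p > N + k + 3 + B" "\<forall>i<k. w (p + i) = w (1 + i)"
      using almost_periodic_recurrent[OF w order_refl] by blast
    then obtain n where "p = Suc n" by (cases p) auto
    then show ?thesis using p unfolding S_def by (intro exI[of _ n]) simp
  qed
  then have infS: "infinite S" unfolding infinite_nat_iff_unbounded by blast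
  let ?A = "cyclic_word_graph w H ` S"
  have "inj_on (cyclic_word_graph w H) S"
  proof (rule inj_onI)
    fix m n assume "cyclic_word_graph w H m = cyclic_word_graph w H n"
    then have "{1..m} = {1..n}" unfolding cyclic_word_graph_def by (metis flip_graph_simps(1))
    then show "m = n" by (metis card_atLeastAtMost diff_Suc_1)
  qed
  then have "infinite ?A" using infS finite_imageD by blast
  moreover have "?A \<subseteq> local_class (word_class w H) k"
    using cyclic_word_graph_local[OF sym w] unfolding S_def by blast
  moreover have "induced_antichain ?A"
    unfolding induced_antichain_def
  proof (intro ballI impI notI)
    fix G K assume "G \<in> ?A" "K \<in> ?A" and ne: "G \<noteq> K" and le: "induced_le G K"
    then obtain m n where mn: "m \<in> S" "n \<in> S"
      and GK: "G = cyclic_word_graph w H m" "K = cyclic_word_graph w H n" by blast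
    obtain f where "induced_emb f G K"
      using le induced_le_iff[of G K] GK by (auto simp: cyclic_word_graph_def)
    then have "m = n"
      using cyclic_word_graphs_incomparable[OF sym fin _ _ N] mn GK unfolding S_def by blast
    then show False using ne GK by simp
  qed
  ultimately show ?thesis unfolding well_quasi_ordered_def by blast
qed

section \<open>Labelled sets of positions with short runs\<close>

text \<open>
  If all runs have length less than \<open>c\<close>, a set of positions with 0/1-labels is, up to moving runs, a
  multiset of words of bounded length over a finite alphabet, so Dickson's lemma applies. The label
  records adjacency to one additional vertex.
\<close>

definition run_type :: "(nat \<Rightarrow> 'v) \<Rightarrow> (nat \<Rightarrow> bool) \<Rightarrow> nat set \<Rightarrow> nat \<Rightarrow> nat \<Rightarrow> ('v \<times> bool) option list" where
  "run_type w lab J c a =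
     map (\<lambda>i. if {a..a + i} \<subseteq> J then Some (w (a + i), lab (a + i)) else None) [0..<c]"

lemma run_type_eqD:
  assumes "run_type w lab' J' c b = run_type w lab J c a" "i < c" "{a..a + i} \<subseteq> J"
  shows "{b..b + i} \<subseteq> J'" "w (b + i) = w (a + i)" "lab' (b + i) = lab (a + i)"
proof -
  have "run_type w lab' J' c b ! i = run_type w lab J c a ! i" using assms(1) by simp
  then show "{b..b + i} \<subseteq> J'" "w (b + i) = w (a + i)" "lab' (b + i) = lab (a + i)"
    using assms(2,3) unfolding run_type_def by (auto split: if_splits)
qed

text \<open>
  Each run is sent to a run of the same type, and distinct runs to distinct runs. The targets are
  maximal runs, so they do not touch.
\<close>
lemma labelled_runs_embed:
  assumes fin: "finite J" "finite J'"
    and short: "\<And>a. \<not> {a..<a + c} \<subseteq> J"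
    and count: "\<And>t. t \<in> run_type w lab J c ` run_start J ` J \<Longrightarrow>
      card {a \<in> run_start J ` J. run_type w lab J c a = t}
        \<le> card {a \<in> run_start J' ` J'. run_type w lab' J' c a = t}"
  shows "\<exists>\<phi>. inj_on \<phi> J \<and> \<phi> ` J \<subseteq> J' \<and>
    (\<forall>x\<in>J. \<forall>y\<in>J. consec (\<phi> x) (\<phi> y) \<longleftrightarrow> consec x y) \<and>
    (\<forall>x\<in>J. w (\<phi> x) = w x \<and> lab' (\<phi> x) = lab x)"
proof -
  obtain g where inj: "inj_on g (run_start J ` J)"
    and g: "\<And>a. a \<in> run_start J ` J \<Longrightarrow>
      g a \<in> run_start J' ` J' \<and> run_type w lab' J' c (g a) = run_type w lab J c a"
    using type_preserving_injection[of "run_start J ` J" "run_start J' ` J'"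
        "run_type w lab J c" "run_type w lab' J' c"] fin count by blast
  let ?\<phi> = "move_runs J g"
  have base: "{g (run_start J x)..?\<phi> x} \<subseteq> J' \<and> w (?\<phi> x) = w x \<and> lab' (?\<phi> x) = lab x"
    if x: "x \<in> J" for x
  proof -
    let ?s = "run_start J x" and ?i = "x - run_start J x"
    have s: "?s + ?i = x" using run_start(1)[OF x] by simp
    have run: "{?s..?s + ?i} \<subseteq> J" unfolding s by (rule run_start(2)[OF x])
    have "?i < c"
    proof (rule ccontr)
      assume "\<not> ?i < c"
      then have "{?s..<?s + c} \<subseteq> {?s..?s + ?i}" by auto
      then show False using run short by blast
    qed
    then show ?thesis
      using run_type_eqD[OF conjunct2[OF g] _ run] x unfolding move_runs_def s by simp
  qed
  have in_J': "?\<phi> x \<in> J'" if x: "x \<in> J" for x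
    using base[OF x] unfolding move_runs_def by (meson atLeastAtMost_iff le_add1 order_refl subsetD)
  have start: "run_start J' (?\<phi> x) = g (run_start J x)" if x: "x \<in> J" for x
  proof -
    obtain y where y: "y \<in> J'" "g (run_start J x) = run_start J' y" using g x by blast
    have "run_start J' (?\<phi> x) = run_start J' (g (run_start J x))"
      using base[OF x] by (intro run_start_cong) (simp_all add: move_runs_def)
    then show ?thesis using y run_start_idem[OF y(1)] by simp
  qed
  have sep: "?\<phi> x \<noteq> ?\<phi> y \<and> \<not> consec (?\<phi> x) (?\<phi> y)"
    if "x \<in> J" "y \<in> J" "run_start J x \<noteq> run_start J y" for x y
  proof -
    have "run_start J' (?\<phi> x) \<noteq> run_start J' (?\<phi> y)"
      using start[OF that(1)] start[OF that(2)] inj that by (simp add: inj_on_eq_iff)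
    then show ?thesis using consec_same_run[OF in_J'[OF that(1)] in_J'[OF that(2)]] by metis
  qed
  show ?thesis
  proof (intro exI conjI ballI)
    show "inj_on ?\<phi> J" using sep by (rule move_runs_inj)
    show "?\<phi> ` J \<subseteq> J'" using in_J' by blast
    show "consec (?\<phi> x) (?\<phi> y) \<longleftrightarrow> consec x y" if "x \<in> J" "y \<in> J" for x y
      using sep that by (rule move_runs_consec)
  qed (use base in blast)+
qed

text \<open>
  Half-open intervals make the condition unsatisfiable for \<open>c = 0\<close>, a bound that can arise when the
  forbidden graph is empty.
\<close>
definition embeds_with_runs_below :: "(nat \<Rightarrow> 'v) \<Rightarrow> 'v pair_pre_digraph \<Rightarrow> nat \<Rightarrow> ngraph \<Rightarrow> (nat \<Rightarrow> nat) \<Rightarrow> bool" where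
  "embeds_with_runs_below w H c K f \<longleftrightarrow>
     induced_emb f K (word_graph w H {1..}) \<and> (\<forall>a. \<not> {a..<a + c} \<subseteq> f ` pverts K)"

lemma one_vertex_extension_emb:
  assumes K: "pair_graph K" "v \<in> pverts K" and K': "pair_graph K'" "v' \<in> pverts K'"
    and f: "induced_emb f (induce K (pverts K - {v})) (word_graph w H {1..})"
    and f': "induced_emb f' (induce K' (pverts K' - {v'})) (word_graph w H {1..})"
    and \<phi>: "inj_on \<phi> (f ` (pverts K - {v}))" "\<phi> ` f ` (pverts K - {v}) \<subseteq> f' ` (pverts K' - {v'})"
    and cons: "\<And>x y. x \<in> f ` (pverts K - {v}) \<Longrightarrow> y \<in> f ` (pverts K - {v}) \<Longrightarrow>
      consec (\<phi> x) (\<phi> y) \<longleftrightarrow> consec x y"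
    and letter: "\<And>x. x \<in> f ` (pverts K - {v}) \<Longrightarrow> w (\<phi> x) = w x"
    and lab: "\<And>x. x \<in> f ` (pverts K - {v}) \<Longrightarrow>
      (inv_into (pverts K' - {v'}) f' (\<phi> x), v') \<in> parcs K' \<longleftrightarrow> (inv_into (pverts K - {v}) f x, v) \<in> parcs K"
  shows "\<exists>\<psi>. induced_emb \<psi> K K'"
proof -
  let ?V = "pverts K - {v}" and ?V' = "pverts K' - {v'}"
  have inj: "inj_on f ?V" and one: "\<And>x. x \<in> ?V \<Longrightarrow> 1 \<le> f x"
    and arc: "\<And>x y. x \<in> ?V \<Longrightarrow> y \<in> ?V \<Longrightarrow> (x, y) \<in> parcs K \<longleftrightarrow>
      f x \<noteq> f y \<and> ((w (f x), w (f y)) \<in> parcs H) \<noteq> consec (f x) (f y)"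
    using f unfolding induced_emb_def word_graph_eq by (auto simp: image_subset_iff)
  have inj': "inj_on f' ?V'"
    and arc': "\<And>x y. x \<in> ?V' \<Longrightarrow> y \<in> ?V' \<Longrightarrow> (x, y) \<in> parcs K' \<longleftrightarrow>
      f' x \<noteq> f' y \<and> ((w (f' x), w (f' y)) \<in> parcs H) \<noteq> consec (f' x) (f' y)"
    using f' unfolding induced_emb_def word_graph_eq by (auto simp: image_subset_iff)
  define g where "g u = inv_into ?V' f' (\<phi> (f u))" for u
  have g: "g u \<in> ?V'" "f' (g u) = \<phi> (f u)" if "u \<in> ?V" for u
  proof -
    have "\<phi> (f u) \<in> f' ` ?V'" using that \<phi>(2) by blast
    then show "g u \<in> ?V'" "f' (g u) = \<phi> (f u)"
      unfolding g_def by (rule inv_into_into, rule f_inv_into_f)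
  qed
  have inj_g: "g u = g u' \<longleftrightarrow> u = u'" if "u \<in> ?V" "u' \<in> ?V" for u u'
  proof
    assume "g u = g u'"
    then have "\<phi> (f u) = \<phi> (f u')" using g(2) that by metis
    then have "f u = f u'" using \<phi>(1) that by (meson imageI inj_onD)
    then show "u = u'" using inj that by (meson inj_onD)
  qed simp
  have arc_g: "(g u, g u') \<in> parcs K' \<longleftrightarrow> (u, u') \<in> parcs K" if u: "u \<in> ?V" "u' \<in> ?V" for u u'
  proof -
    have fu: "f u \<in> f ` ?V" "f u' \<in> f ` ?V" using u by blast+
    have "\<phi> (f u) = \<phi> (f u') \<longleftrightarrow> f u = f u'" using \<phi>(1) fu by (rule inj_on_eq_iff)
    then show ?thesis
      unfolding arc[OF u] arc'[OF g(1)[OF u(1)] g(1)[OF u(2)]]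
      using g(2)[OF u(1)] g(2)[OF u(2)] cons[OF fu] letter[OF fu(1)] letter[OF fu(2)] by simp
  qed
  have lab_g: "(g u, v') \<in> parcs K' \<longleftrightarrow> (u, v) \<in> parcs K" if u: "u \<in> ?V" for u
    using lab[of "f u"] u inj unfolding g_def by simp
  have sym: "(x, y) \<in> parcs K \<longleftrightarrow> (y, x) \<in> parcs K" "(x, x) \<notin> parcs K"
    "(x, y) \<in> parcs K' \<longleftrightarrow> (y, x) \<in> parcs K'" "(x, x) \<notin> parcs K'" for x y
    using K(1) K'(1) unfolding pair_graph_iff by blast+
  define \<psi> where "\<psi> u = (if u = v then v' else g u)" for u
  have "induced_emb \<psi> K K'"
    unfolding induced_emb_def
  proof (intro conjI ballI)
    show "inj_on \<psi> (pverts K)"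
    proof (rule inj_onI)
      fix x y assume "x \<in> pverts K" "y \<in> pverts K" "\<psi> x = \<psi> y"
      then show "x = y" using g(1)[of x] g(1)[of y] inj_g[of x y]
        unfolding \<psi>_def by (auto split: if_splits)
    qed
    show "\<psi> ` pverts K \<subseteq> pverts K'" using g(1) K'(2) unfolding \<psi>_def by auto
    fix x y assume xy: "x \<in> pverts K" "y \<in> pverts K"
    consider "x = v" "y = v" | "x = v" "y \<noteq> v" | "x \<noteq> v" "y = v" | "x \<noteq> v" "y \<noteq> v" by blast
    then show "(x, y) \<in> parcs K \<longleftrightarrow> (\<psi> x, \<psi> y) \<in> parcs K'"
    proof cases
      case 1 then show ?thesis using sym(2,4) by (simp add: \<psi>_def)
    next
      case 2
      have "(v, y) \<in> parcs K \<longleftrightarrow> (y, v) \<in> parcs K" "(v', g y) \<in> parcs K' \<longleftrightarrow> (g y, v') \<in> parcs K'"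
        using sym by blast+
      then show ?thesis using 2 lab_g[of y] xy by (simp add: \<psi>_def)
    next
      case 3 then show ?thesis using lab_g[of x] xy by (simp add: \<psi>_def)
    next
      case 4 then show ?thesis using arc_g[of x y] xy by (simp add: \<psi>_def)
    qed
  qed
  then show ?thesis by blast
qed

text \<open>
  This covers graphs whose runs become short only after the deletion of a vertex, and thus also the
  minimal graphs outside the class of graphs with short runs.
\<close>
lemma one_vertex_extensions_wqo:
  fixes K :: "nat \<Rightarrow> ngraph" and v :: "nat \<Rightarrow> nat"
  assumes fin: "finite (w ` {1..})"
    and K: "\<And>n. pair_graph (K n)" and v: "\<And>n. v n \<in> pverts (K n)"
    and short: "\<And>n. \<exists>f. embeds_with_runs_below w H c (induce (K n) (pverts (K n) - {v n})) f"
  shows "\<exists>r :: nat \<Rightarrow> nat. strict_mono r \<and> (\<forall>i j. i \<le> j \<longrightarrow> (\<exists>\<psi>. induced_emb \<psi> (K (r i)) (K (r j))))"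
proof -
  define V where "V n = pverts (K n) - {v n}" for n
  obtain f where f: "\<And>n. embeds_with_runs_below w H c (induce (K n) (V n)) (f n)"
    using short unfolding V_def by metis
  have induced_emb_f: "induced_emb (f n) (induce (K n) (V n)) (word_graph w H {1..})" for n
    using f unfolding embeds_with_runs_below_def by blast
  define J where "J n = f n ` V n" for n
  have no_run: "\<not> {a..<a + c} \<subseteq> J n" for a n
    using f unfolding embeds_with_runs_below_def J_def by simp
  have finJ: "finite (J n)" for n
    using K unfolding J_def V_def pair_graph_iff by blast
  have J1: "J n \<subseteq> {1..}" for n
    using induced_emb_f[of n] unfolding induced_emb_def J_def word_graph_eq by simp
  define lab where "lab n x \<longleftrightarrow> (inv_into (V n) (f n) x, v n) \<in> parcs (K n)" for n x
  let ?type = "\<lambda>n. run_type w (lab n) (J n) c"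
  let ?letters = "insert None (Some ` (w ` {1..} \<times> (UNIV :: bool set)))"
  define T where "T = {xs. set xs \<subseteq> ?letters \<and> length xs = c}"
  have "finite (w ` {1..} \<times> (UNIV :: bool set))"
    using fin finite by (rule finite_cartesian_product)
  then have finT: "finite T"
    unfolding T_def by (intro finite_lists_length_eq finite.insertI finite_imageI)
  have type_T: "?type n a \<in> T" for n a
  proof -
    have "w (a + i) \<in> w ` {1..}" if "{a..a + i} \<subseteq> J n" for i
    proof -
      have "a + i \<in> {a..a + i}" by simp
      then show ?thesis using that J1[of n] by blast
    qed
    then show ?thesis unfolding T_def run_type_def by auto
  qed
  define count where "count n t = card {a \<in> run_start (J n) ` J n. ?type n a = t}" for n t
  obtain r :: "nat \<Rightarrow> nat" where rr: "strict_mono r \<and> (\<forall>t\<in>T. \<forall>i j. i \<le> j \<longrightarrow> count (r i) t \<le> count (r j) t)"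
    using dickson[OF finT, of count] ..
  then have r: "strict_mono r" "\<And>i j t. i \<le> j \<Longrightarrow> t \<in> T \<Longrightarrow> count (r i) t \<le> count (r j) t"
    by simp_all
  have "\<exists>\<psi>. induced_emb \<psi> (K (r i)) (K (r j))" if ij: "i \<le> j" for i j
  proof -
    have le: "card {a \<in> run_start (J (r i)) ` J (r i). ?type (r i) a = t}
        \<le> card {a \<in> run_start (J (r j)) ` J (r j). ?type (r j) a = t}"
      if "t \<in> ?type (r i) ` run_start (J (r i)) ` J (r i)" for t
      using r(2)[OF ij, of t] that type_T unfolding count_def by blast
    obtain \<phi> where phi: "inj_on \<phi> (J (r i))" "\<phi> ` J (r i) \<subseteq> J (r j)"
      "\<And>x y. x \<in> J (r i) \<Longrightarrow> y \<in> J (r i) \<Longrightarrow> consec (\<phi> x) (\<phi> y) \<longleftrightarrow> consec x y"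
      "\<And>x. x \<in> J (r i) \<Longrightarrow> w (\<phi> x) = w x"
      "\<And>x. x \<in> J (r i) \<Longrightarrow> lab (r j) (\<phi> x) = lab (r i) x"
      using labelled_runs_embed[OF finJ finJ no_run le] by blast
    show ?thesis
      by (rule one_vertex_extension_emb[OF K v K v induced_emb_f[unfolded V_def] induced_emb_f[unfolded V_def]])
        (fact phi[unfolded J_def lab_def V_def])+
  qed
  then show ?thesis using r(1) by blast
qed

text \<open>
  A graph of the word class lies in the graph of some prefix of \<open>w\<close>. By almost periodicity every
  sufficiently long factor contains this prefix, so a long run would produce the forbidden graph.
\<close>
lemma forbidding_bounds_runs:
  assumes w: "almost_periodic w" and G: "G \<in> word_class w H"
  shows "\<exists>c. \<forall>K\<in>word_class w H. (\<nexists>g. induced_emb g G K) \<longrightarrow>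
    (\<exists>f. embeds_with_runs_below w H c K f)"
proof -
  obtain f where finG: "finite (pverts G)" and f: "induced_emb f G (word_graph w H {1..})"
    using G unfolding word_class_iff by blast
  obtain N where N: "\<And>x. x \<in> pverts G \<Longrightarrow> f x \<le> N"
    using finite_imageI[OF finG, of f] unfolding finite_nat_set_iff_bounded_le by blast
  have f1: "1 \<le> f x" if "x \<in> pverts G" for x
    using f that unfolding induced_emb_def word_graph_eq by auto
  obtain c where c: "\<And>b. b \<ge> 1 \<Longrightarrow> \<exists>p\<ge>b. p + N \<le> b + c \<and> (\<forall>i<N. w (p + i) = w (1 + i))"
    using almost_periodic_window[OF w order_refl] by blast
  have "\<exists>f. embeds_with_runs_below w H c K f" if K: "K \<in> word_class w H" and no: "\<nexists>g. induced_emb g G K" for K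
  proof -
    obtain h where h: "induced_emb h K (word_graph w H {1..})"
      using K unfolding word_class_iff by blast
    let ?J = "h ` pverts K"
    have J1: "?J \<subseteq> {1..}" using h unfolding induced_emb_def word_graph_eq by simp
    have False if run: "{a..<a + c} \<subseteq> ?J" for a
    proof -
      define b where "b = max 1 a"
      have "{b..<b + c} \<subseteq> ?J"
      proof (cases "c = 0 \<or> a \<ge> 1")
        case True then show ?thesis using run unfolding b_def by auto
      next
        case False
        then have "0 \<in> {a..<a + c}" by auto
        then have "0 \<in> {1::nat..}" using run J1 by blast
        then show ?thesis by simp
      qed
      moreover obtain p where p: "p \<ge> b" "p + N \<le> b + c" "\<And>i. i < N \<Longrightarrow> w (p + i) = w (1 + i)"
        using c[of b] unfolding b_def by auto
      ultimately have window: "p + i \<in> ?J" if "i < N" for i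
        using that by (auto simp: subset_iff)
      let ?s = "\<lambda>x. p + (x - 1)"
      have "induced_emb f G (flip_graph (parcs H) w consec (f ` pverts G))"
        using f unfolding induced_emb_def word_graph_eq by auto
      moreover have "induced_emb ?s (flip_graph (parcs H) w consec (f ` pverts G)) (flip_graph (parcs H) w consec ?J)"
      proof (rule induced_emb_flip_graph)
        have bounds: "1 \<le> x \<and> x \<le> N" if "x \<in> f ` pverts G" for x using f1 N that by blast
        show "inj_on ?s (f ` pverts G)" by (rule inj_onI) (auto dest!: bounds)
        show "?s ` f ` pverts G \<subseteq> ?J"
        proof
          fix z assume "z \<in> ?s ` f ` pverts G"
          then obtain x where "x \<in> f ` pverts G" "z = ?s x" by blast
          moreover from this have "x - 1 < N" using bounds[of x] by auto
          ultimately show "z \<in> ?J" using window by blast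
        qed
        show "consec (?s x) (?s y) \<longleftrightarrow> consec x y" if "x \<in> f ` pverts G" "y \<in> f ` pverts G" for x y
          using bounds[OF that(1)] bounds[OF that(2)] unfolding consec_def by auto
        show "w (?s x) = w x" if "x \<in> f ` pverts G" for x
        proof -
          have "x - 1 < N" "1 + (x - 1) = x" using bounds[OF that] by auto
          then show ?thesis using p(3)[of "x - 1"] by (simp only:)
        qed
      qed
      moreover obtain h' where "induced_emb h' (flip_graph (parcs H) w consec ?J) K"
      proof -
        have "induced_emb h K (flip_graph (parcs H) w consec ?J)"
          using h J1 unfolding induced_emb_def word_graph_eq by (simp add: subset_iff)
        then show ?thesis using induced_emb_inverse that by (metis flip_graph_simps(1))
      qed
      ultimately show False using no induced_emb_trans by blast
    qed
    then show ?thesis using h unfolding embeds_with_runs_below_def by blast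
  qed
  then show ?thesis by blast
qed

section \<open>Boundary classes\<close>

lemma limit_class_word_class:
  assumes sym: "\<And>a b. (a, b) \<in> parcs H \<Longrightarrow> (b, a) \<in> parcs H"
    and fin: "finite (w ` {1..})" and w: "almost_periodic w"
  shows "limit_class (word_class w H)"
  unfolding limit_class_def
proof (intro exI conjI allI)
  let ?C = "word_class w H"
  have C: "graph_class ?C" using sym by (rule graph_class_word_class)
  show "graph_class (local_class ?C k)" for k using C by (rule graph_class_local_class)
  show "\<not> well_quasi_ordered (local_class ?C k)" for k
    using sym fin w by (rule local_word_class_not_wqo)
  show "local_class ?C (Suc k) \<subseteq> local_class ?C k" for k by (rule local_class_Suc)
  show "?C = (\<Inter>k. local_class ?C k)" using Inter_local_class[OF C] by simp
qed

lemma empty_graph_mem: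
  assumes C: "graph_class C" "\<not> well_quasi_ordered C" and K: "pair_wf_digraph K" "pverts K = {}"
  shows "K \<in> C"
proof -
  have "well_quasi_ordered {}" unfolding well_quasi_ordered_def by simp
  then have "C \<noteq> {}" using C(2) by metis
  then obtain G where "G \<in> C" by blast
  then show ?thesis using graph_class_down[OF C(1) _ K(1), of G id] K(2) unfolding induced_emb_def by simp
qed

text \<open>
  Let \<open>G\<close> be a graph of the word class missing from \<open>D = (\<Inter>i. Ds i)\<close>, and let \<open>X\<close> consist of the graphs
  of the word class without \<open>G\<close>. No \<open>Ds i\<close> lies within \<open>X\<close>, because \<open>X\<close> is well-quasi-ordered. Choose
  \<open>K i\<close> in \<open>Ds i\<close> outside \<open>X\<close> with fewest vertices. Deleting a vertex from it leads into \<open>X\<close>, so some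
  \<open>K i\<close> embeds into \<open>K j\<close> for infinitely many \<open>j\<close>. That \<open>K i\<close> belongs to all \<open>Ds j\<close>, hence to
  \<open>D\<close>, which is a subset of \<open>X\<close>: a contradiction.
\<close>
lemma not_limit_class_below:
  assumes C: "graph_class (word_class w H)"
    and fin: "finite (w ` {1..})" and w: "almost_periodic w"
    and D: "D \<subset> word_class w H"
  shows "\<not> limit_class D"
proof
  assume "limit_class D"
  then obtain Ds where Ds: "\<And>i. graph_class (Ds i)" "\<And>i. \<not> well_quasi_ordered (Ds i)"
      "\<And>i. Ds (Suc i) \<subseteq> Ds i" and DI: "D = (\<Inter>i. Ds i)"
    unfolding limit_class_def by blast
  have anti: "Ds j \<subseteq> Ds i" if "i \<le> j" for i j
    using lift_Suc_antimono_le[of Ds, OF Ds(3) that] .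
  obtain G where G: "G \<in> word_class w H" "G \<notin> D" using D by blast
  have wfG: "pair_wf_digraph G" using G(1) unfolding word_class_iff by blast
  define X where "X = {K \<in> word_class w H. \<nexists>g. induced_emb g G K}"
  have D_X: "D \<subseteq> X"
  proof
    fix K assume K: "K \<in> D"
    have "\<nexists>g. induced_emb g G K"
    proof
      assume "\<exists>g. induced_emb g G K"
      then have "G \<in> Ds i" for i using graph_class_down[OF Ds(1) _ wfG] K DI by blast
      then show False using G(2) DI by blast
    qed
    then show "K \<in> X" using K D unfolding X_def by blast
  qed
  have X_down: "induce K S \<in> X" if K: "K \<in> X" and S: "S \<subseteq> pverts K" for K S
  proof -
    have "K \<in> word_class w H" "\<nexists>g. induced_emb g G K" using K unfolding X_def by blast+
    moreover from this have "\<nexists>g. induced_emb g G (induce K S)"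
      using induced_emb_trans[OF _ induced_emb_induce[OF S]] by blast
    ultimately show ?thesis
      using graph_class_down[OF C _ pair_wf_induce induced_emb_induce[OF S]] unfolding X_def by blast
  qed
  obtain c where "\<forall>K\<in>word_class w H. (\<nexists>g. induced_emb g G K) \<longrightarrow> (\<exists>f. embeds_with_runs_below w H c K f)"
    using forbidding_bounds_runs[OF w G(1)] ..
  then have c: "\<exists>f. embeds_with_runs_below w H c K f" if "K \<in> X" for K
    using that unfolding X_def by simp
  have graph: "pair_graph K" if "K \<in> Ds i" for K i using Ds(1) that unfolding graph_class_def by blast
  have not_sub: "\<exists>K. K \<in> Ds i \<and> K \<notin> X" for i
  proof (rule ccontr)
    assume "\<nexists>K. K \<in> Ds i \<and> K \<notin> X"
    then have sub: "Ds i \<subseteq> X" by blast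
    obtain A where A: "A \<subseteq> Ds i" "infinite A" "induced_antichain A"
      using Ds(2) unfolding well_quasi_ordered_def by blast
    let ?A = "{K \<in> A. pverts K \<noteq> {}}"
    have "K = \<lparr>pverts = {}, parcs = {}\<rparr>" if K: "K \<in> A - ?A" for K
    proof -
      have "K \<in> Ds i" using K A(1) by blast
      then interpret pair_wf_digraph K by (intro pair_graph_wf graph)
      have "pverts K = {}" using K by simp
      moreover then have "parcs K = {}" using arc_fst_in_verts by blast
      ultimately show ?thesis by (intro pair_pre_digraph.equality) simp_all
    qed
    then have "A - ?A \<subseteq> {\<lparr>pverts = {}, parcs = {}\<rparr>}" by blast
    then have "finite (A - ?A)" by (rule finite_subset) simp
    then have "infinite ?A" using A(2) by (metis finite_Diff2)
    then obtain K :: "nat \<Rightarrow> ngraph" where K: "inj K" "range K \<subseteq> ?A"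
      using infinite_countable_subset by blast
    have KA: "K n \<in> A" and ne: "pverts (K n) \<noteq> {}" for n using K(2) by auto
    define v where "v n = (SOME x. x \<in> pverts (K n))" for n
    have v: "v n \<in> pverts (K n)" for n unfolding v_def some_in_eq by (rule ne)
    have KD: "K n \<in> Ds i" for n using KA A(1) by blast
    have KX: "K n \<in> X" for n using KD sub by blast
    have Kg: "pair_graph (K n)" for n using KD by (rule graph)
    obtain r :: "nat \<Rightarrow> nat" where rr: "strict_mono r \<and> (\<forall>i j. i \<le> j \<longrightarrow> (\<exists>\<psi>. induced_emb \<psi> (K (r i)) (K (r j))))"
      using one_vertex_extensions_wqo[OF fin Kg v c[OF X_down[OF KX Diff_subset]]] ..
    then have r: "strict_mono r" "\<And>i j. i \<le> j \<Longrightarrow> \<exists>\<psi>. induced_emb \<psi> (K (r i)) (K (r j))"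
      by simp_all
    have "K (r 0) \<noteq> K (r 1)" using K(1) r(1) by (simp add: inj_eq strict_mono_eq)
    moreover have "induced_le (K (r 0)) (K (r 1))"
      using induced_le_iff[OF pair_graph_wf[OF Kg] pair_graph_wf[OF Kg]] r(2)[of 0 1] by simp
    ultimately show False using A(3) KA unfolding induced_antichain_def by blast
  qed
  have "\<exists>K. (K \<in> Ds i \<and> K \<notin> X) \<and> (\<forall>M. M \<in> Ds i \<and> M \<notin> X \<longrightarrow> card (pverts K) \<le> card (pverts M))" for i
    using not_sub ex_has_least_nat[of "\<lambda>K. K \<in> Ds i \<and> K \<notin> X" _ "\<lambda>K. card (pverts K)"] by blast
  then obtain K where K: "\<And>i. K i \<in> Ds i" "\<And>i. K i \<notin> X"
    and least: "\<And>i M. M \<in> Ds i \<Longrightarrow> M \<notin> X \<Longrightarrow> card (pverts (K i)) \<le> card (pverts M)"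
    by metis
  have ne: "pverts (K i) \<noteq> {}" for i
  proof
    assume "pverts (K i) = {}"
    then have "K i \<in> Ds j" for j
      using empty_graph_mem[OF Ds(1,2)] graph[OF K(1)] pair_graph_wf by blast
    then show False using K(2) D_X DI by blast
  qed
  define v where "v i = (SOME x. x \<in> pverts (K i))" for i
  have v: "v i \<in> pverts (K i)" for i unfolding v_def some_in_eq by (rule ne)
  have del: "induce (K i) (pverts (K i) - {v i}) \<in> X" for i
  proof (rule ccontr)
    let ?M = "induce (K i) (pverts (K i) - {v i})"
    assume "?M \<notin> X"
    moreover have "?M \<in> Ds i"
      using graph_class_down[OF Ds(1) K(1) pair_wf_induce induced_emb_induce] by blast
    ultimately have "card (pverts (K i)) \<le> card (pverts ?M)" using least by blast
    moreover have "finite (pverts (K i))" using graph[OF K(1)] unfolding pair_graph_iff by blast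
    ultimately show False using card_Diff1_less[of "pverts (K i)" "v i"] v[of i] by simp
  qed
  obtain r :: "nat \<Rightarrow> nat" where rr: "strict_mono r \<and> (\<forall>i j. i \<le> j \<longrightarrow> (\<exists>\<psi>. induced_emb \<psi> (K (r i)) (K (r j))))"
    using one_vertex_extensions_wqo[OF fin graph[OF K(1)] v c[OF del]] ..
  then have r: "strict_mono r" "\<And>i j. i \<le> j \<Longrightarrow> \<exists>\<psi>. induced_emb \<psi> (K (r i)) (K (r j))"
    by simp_all
  have "K (r 0) \<in> Ds j" for j
  proof -
    obtain \<psi> where "induced_emb \<psi> (K (r 0)) (K (r j))" using r(2)[of 0 j] by blast
    then have "K (r 0) \<in> Ds (r j)"
      using graph_class_down[OF Ds(1) K(1)] pair_graph_wf[OF graph[OF K(1)]] by blast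
    then show ?thesis using anti[of j "r j"] strict_mono_imp_increasing[OF r(1)] by blast
  qed
  then show False using K(2) D_X DI by blast
qed

theorem theorem4p11:
  fixes H :: "'v pair_pre_digraph" and w :: "nat \<Rightarrow> 'v"
  assumes "pair_pseudo_graph H"
    and "\<And>i. i \<ge> 1 \<Longrightarrow> w i \<in> pverts H"
    and "almost_periodic w"
  shows "boundary_class (word_class w H)"
proof -
  interpret pair_pseudo_graph H by fact
  have fin: "finite (w ` {1..})"
    using assms(2) by (intro finite_subset[OF _ pair_finite_verts]) auto
  have sym: "\<And>a b. (a, b) \<in> parcs H \<Longrightarrow> (b, a) \<in> parcs H" by (rule arcs_symmetric)
  show ?thesis
    unfolding boundary_class_def
    using limit_class_word_class[OF sym fin assms(3)]
      not_limit_class_below[OF graph_class_word_class[OF sym] fin assms(3)] by blast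
qed

end
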